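(* Let $S$ be a finite inverse semigroup. Then the universal bias $\operatorname{U_{bis}}(S)$ is finite.
   Context: A semigroup $S$ is inverse if every $x\in S$ has a unique $x^{-1}$ with $x=xx^{-1}x$ and $x^{-1}=x^{-1}xx^{-1}$. The natural ordering is $x\le y$ iff $x=yx^{-1}x$. In an inverse semigroup with zero, $x,y$ are orthogonal if $x^{-1}y=xy^{-1}=0$. A Boolean inverse semigroup is an inverse semigroup with zero whose idempotents form a generalized Boolean algebra and in which any two orthogonal $x,y$ have a join $x\oplus y$ for the natural ordering. A bias is the same as a Boolean inverse semigroup (viewed as an algebra in a suitable variety), and bias homomorphisms are exactly the semigroup homomorphisms $f$ with $f(0)=0$ and $f(x\oplus y)=f(x)\oplus f(y)$ for orthogonal $x,y$. The universal bias $\operatorname{U_{bis}}(S)$ of an inverse semigroup $S$ is a bias together with a semigroup homomorphism $S\to\operatorname{U_{bis}}(S)$ such that every semigroup homomorphism from $S$ to a bias $T$ factors through it via a unique bias homomorphism $\operatorname{U_{bis}}(S)\to T$. *)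

theory Defs
  imports "HOL-Algebra.Lattice"
begin

section \<open>Inverse semigroups\<close>

record 'a magma = "'a partial_object" +
  mul :: "'a \<Rightarrow> 'a \<Rightarrow> 'a" (infixl \<open>\<cdot>\<index>\<close> 70)

definition is_inverse :: "'a magma \<Rightarrow> 'a \<Rightarrow> 'a \<Rightarrow> bool" where
  "is_inverse S x y \<longleftrightarrow> y \<in> carrier S \<and> x = x \<cdot>\<^bsub>S\<^esub> y \<cdot>\<^bsub>S\<^esub> x \<and> y = y \<cdot>\<^bsub>S\<^esub> x \<cdot>\<^bsub>S\<^esub> y"

locale inverse_semigroup =
  fixes S :: "'a magma" (structure)
  assumes mul_closed [simp, intro]: "\<lbrakk>x \<in> carrier S; y \<in> carrier S\<rbrakk> \<Longrightarrow> x \<cdot> y \<in> carrier S"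
    and mul_assoc: "\<lbrakk>x \<in> carrier S; y \<in> carrier S; z \<in> carrier S\<rbrakk> \<Longrightarrow> (x \<cdot> y) \<cdot> z = x \<cdot> (y \<cdot> z)"
    and ex1_inverse: "x \<in> carrier S \<Longrightarrow> \<exists>!y. is_inverse S x y"

definition sinv :: "'a magma \<Rightarrow> 'a \<Rightarrow> 'a" (\<open>inv\<index> _\<close> [81] 80) where
  "inv\<^bsub>S\<^esub> x = (THE y. is_inverse S x y)"

definition idems :: "'a magma \<Rightarrow> 'a set" where
  "idems S = {e \<in> carrier S. e \<cdot>\<^bsub>S\<^esub> e = e}"

definition nat_order :: "'a magma \<Rightarrow> 'a gorder" where
  "nat_order S = \<lparr>carrier = carrier S, eq = (=), le = (\<lambda>x y. x = y \<cdot>\<^bsub>S\<^esub> inv\<^bsub>S\<^esub> x \<cdot>\<^bsub>S\<^esub> x)\<rparr>"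

definition idem_order :: "'a magma \<Rightarrow> 'a gorder" where
  "idem_order S = (nat_order S)\<lparr>carrier := idems S\<rparr>"

definition semigroup_hom :: "'a magma \<Rightarrow> 'b magma \<Rightarrow> ('a \<Rightarrow> 'b) set" where
  "semigroup_hom S T = {f \<in> carrier S \<rightarrow> carrier T.
     \<forall>x\<in>carrier S. \<forall>y\<in>carrier S. f (x \<cdot>\<^bsub>S\<^esub> y) = f x \<cdot>\<^bsub>T\<^esub> f y}"


section \<open>Boolean inverse semigroups (biases)\<close>

locale generalized_boolean_algebra = lattice L + weak_partial_order_bottom L
  for L :: "'a gorder" (structure) +
  assumes meet_join_distrib:
      "\<lbrakk>x \<in> carrier L; y \<in> carrier L; z \<in> carrier L\<rbrakk> \<Longrightarrow> x \<sqinter> (y \<squnion> z) = (x \<sqinter> y) \<squnion> (x \<sqinter> z)"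
    and relative_complement:
      "\<lbrakk>x \<in> carrier L; y \<in> carrier L; x \<sqsubseteq> y\<rbrakk>
        \<Longrightarrow> \<exists>z\<in>carrier L. z \<sqinter> x = \<bottom> \<and> z \<squnion> x = y"

definition is_zero :: "'a magma \<Rightarrow> 'a \<Rightarrow> bool" where
  "is_zero S z \<longleftrightarrow> z \<in> carrier S \<and> (\<forall>x\<in>carrier S. x \<cdot>\<^bsub>S\<^esub> z = z \<and> z \<cdot>\<^bsub>S\<^esub> x = z)"

definition zero :: "'a magma \<Rightarrow> 'a" (\<open>\<zero>\<index>\<close>) where
  "\<zero>\<^bsub>S\<^esub> = (THE z. is_zero S z)"

definition orthogonal :: "'a magma \<Rightarrow> 'a \<Rightarrow> 'a \<Rightarrow> bool" where
  "orthogonal S x y \<longleftrightarrow> (inv\<^bsub>S\<^esub> x) \<cdot>\<^bsub>S\<^esub> y = \<zero>\<^bsub>S\<^esub> \<and> x \<cdot>\<^bsub>S\<^esub> (inv\<^bsub>S\<^esub> y) = \<zero>\<^bsub>S\<^esub>"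

definition osum :: "'a magma \<Rightarrow> 'a \<Rightarrow> 'a \<Rightarrow> 'a" (infixl \<open>\<oplus>\<index>\<close> 65) where
  "x \<oplus>\<^bsub>S\<^esub> y = x \<squnion>\<^bsub>nat_order S\<^esub> y"

locale bias = inverse_semigroup S for S :: "'a magma" (structure) +
  assumes zero_exists: "\<exists>z. is_zero S z"
    and idems_gba: "generalized_boolean_algebra (idem_order S)"
    and orthogonal_join:
      "\<lbrakk>x \<in> carrier S; y \<in> carrier S; orthogonal S x y\<rbrakk> \<Longrightarrow> \<exists>s. is_lub (nat_order S) s {x, y}"

definition bias_hom :: "'a magma \<Rightarrow> 'b magma \<Rightarrow> ('a \<Rightarrow> 'b) set" where
  "bias_hom S T = {f \<in> semigroup_hom S T. f \<zero>\<^bsub>S\<^esub> = \<zero>\<^bsub>T\<^esub> \<and>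
     (\<forall>x\<in>carrier S. \<forall>y\<in>carrier S. orthogonal S x y \<longrightarrow> f (x \<oplus>\<^bsub>S\<^esub> y) = f x \<oplus>\<^bsub>T\<^esub> f y)}"


section \<open>The universal bias\<close>

text \<open>
  A proposition cannot quantify over all types, so the type carrying the test biases \<open>T\<close> is a
  parameter. A hypothesis \<open>universal_bias TYPE('c) S U j\<close> is implied by the unrestricted universal
  property, whatever \<open>'c\<close> is. Existence for every \<open>S\<close>, with a single \<open>U\<close> serving all
  types \<open>'c\<close>, is \<open>U_bis_universal\<close> at the end of this theory.
\<close>

definition universal_bias ::
    "'c itself \<Rightarrow> 'a magma \<Rightarrow> 'u magma \<Rightarrow> ('a \<Rightarrow> 'u) \<Rightarrow> bool" where
  "universal_bias C S U j \<longleftrightarrow> bias U \<and> j \<in> semigroup_hom S U \<and>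
     (\<forall>(T :: 'c magma) f. bias T \<longrightarrow> f \<in> semigroup_hom S T \<longrightarrow>
       (\<exists>g\<in>bias_hom U T. (\<forall>s\<in>carrier S. g (j s) = f s) \<and>
         (\<forall>g'\<in>bias_hom U T. (\<forall>s\<in>carrier S. g' (j s) = f s) \<longrightarrow>
           (\<forall>u\<in>carrier U. g' u = g u))))"


section \<open>A presentation of the universal bias\<close>

text \<open>
  Biases form a variety in the operations zero, inversion, multiplication, skew difference and skew
  addition. The universal bias is presented by generators \<open>s \<in> S\<close> and the multiplication table of
  \<open>S\<close> as relations: its elements are terms, identified iff they agree in all biases under all
  interpretations of the generators by semigroup homomorphisms. Every bias generated by an image
  of \<open>S\<close> has a copy whose elements are terms (\<open>generated_copy\<close>), so \<open>term_eq\<close> may restrict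
  to biases on the type of terms.
\<close>

definition rel_diff :: "'a gorder \<Rightarrow> 'a \<Rightarrow> 'a \<Rightarrow> 'a" where
  "rel_diff L x y = (THE z. z \<in> carrier L \<and> z \<sqinter>\<^bsub>L\<^esub> (x \<sqinter>\<^bsub>L\<^esub> y) = \<bottom>\<^bsub>L\<^esub> \<and> z \<squnion>\<^bsub>L\<^esub> (x \<sqinter>\<^bsub>L\<^esub> y) = x)"

definition d_idem :: "'a magma \<Rightarrow> 'a \<Rightarrow> 'a" where
  "d_idem S x = (inv\<^bsub>S\<^esub> x) \<cdot>\<^bsub>S\<^esub> x"

definition r_idem :: "'a magma \<Rightarrow> 'a \<Rightarrow> 'a" where
  "r_idem S x = x \<cdot>\<^bsub>S\<^esub> (inv\<^bsub>S\<^esub> x)"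

definition skew_diff :: "'a magma \<Rightarrow> 'a \<Rightarrow> 'a \<Rightarrow> 'a" (infixl \<open>\<ominus>\<index>\<close> 65) where
  "x \<ominus>\<^bsub>S\<^esub> y = rel_diff (idem_order S) (r_idem S x) (r_idem S y) \<cdot>\<^bsub>S\<^esub> x
               \<cdot>\<^bsub>S\<^esub> rel_diff (idem_order S) (d_idem S x) (d_idem S y)"

definition skew_add :: "'a magma \<Rightarrow> 'a \<Rightarrow> 'a \<Rightarrow> 'a" (infixl \<open>\<nabla>\<index>\<close> 65) where
  "x \<nabla>\<^bsub>S\<^esub> y = (x \<ominus>\<^bsub>S\<^esub> y) \<oplus>\<^bsub>S\<^esub> y"

datatype 'a bterm =
    Gen 'a
  | Zero
  | Inv "'a bterm"
  | Mul "'a bterm" "'a bterm"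
  | Diff "'a bterm" "'a bterm"
  | Add "'a bterm" "'a bterm"

primrec eval :: "'b magma \<Rightarrow> ('a \<Rightarrow> 'b) \<Rightarrow> 'a bterm \<Rightarrow> 'b" where
  "eval T f (Gen a) = f a"
| "eval T f Zero = \<zero>\<^bsub>T\<^esub>"
| "eval T f (Inv t) = inv\<^bsub>T\<^esub> (eval T f t)"
| "eval T f (Mul t u) = eval T f t \<cdot>\<^bsub>T\<^esub> eval T f u"
| "eval T f (Diff t u) = eval T f t \<ominus>\<^bsub>T\<^esub> eval T f u"
| "eval T f (Add t u) = eval T f t \<nabla>\<^bsub>T\<^esub> eval T f u"

definition terms :: "'a magma \<Rightarrow> 'a bterm set" where
  "terms S = {t. set_bterm t \<subseteq> carrier S}"

definition term_eq :: "'a magma \<Rightarrow> ('a bterm \<times> 'a bterm) set" where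
  "term_eq S = {(t, u) \<in> terms S \<times> terms S.
     \<forall>(T :: 'a bterm magma) f. bias T \<longrightarrow> f \<in> semigroup_hom S T \<longrightarrow> eval T f t = eval T f u}"

definition U_bis :: "'a magma \<Rightarrow> 'a bterm set magma" where
  "U_bis S = \<lparr>carrier = terms S // term_eq S,
     mul = (\<lambda>X Y. \<Union>t\<in>X. \<Union>u\<in>Y. term_eq S `` {Mul t u})\<rparr>"

definition U_bis_unit :: "'a magma \<Rightarrow> 'a \<Rightarrow> 'a bterm set" where
  "U_bis_unit S s = term_eq S `` {Gen s}"


section \<open>Basic facts\<close>

context inverse_semigroup
begin

lemma inv_is_inverse: "x \<in> carrier S \<Longrightarrow> is_inverse S x (inv x)"
  unfolding sinv_def by (rule theI') (rule ex1_inverse)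

lemma inv_closed [simp, intro]: "x \<in> carrier S \<Longrightarrow> inv x \<in> carrier S"
  using inv_is_inverse by (auto simp: is_inverse_def)

lemma inv_l: "x \<in> carrier S \<Longrightarrow> x \<cdot> (inv x \<cdot> x) = x"
  using inv_is_inverse[of x] mul_assoc[of x "inv x" x] inv_closed[of x]
  unfolding is_inverse_def by metis

lemma inv_r: "x \<in> carrier S \<Longrightarrow> inv x \<cdot> (x \<cdot> inv x) = inv x"
  using inv_is_inverse[of x] mul_assoc[of "inv x" x "inv x"] inv_closed[of x]
  unfolding is_inverse_def by metis

lemma inv_l2: "x \<in> carrier S \<Longrightarrow> z \<in> carrier S \<Longrightarrow> x \<cdot> (inv x \<cdot> (x \<cdot> z)) = x \<cdot> z"
  using mul_assoc[of x "inv x \<cdot> x" z] by (simp add: inv_l mul_assoc)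

lemma inv_r2: "x \<in> carrier S \<Longrightarrow> z \<in> carrier S \<Longrightarrow> inv x \<cdot> (x \<cdot> (inv x \<cdot> z)) = inv x \<cdot> z"
  using mul_assoc[of "inv x" "x \<cdot> inv x" z] by (simp add: inv_r mul_assoc)

lemma inv_unique:
  "\<lbrakk>x \<in> carrier S; y \<in> carrier S; x \<cdot> (y \<cdot> x) = x; y \<cdot> (x \<cdot> y) = y\<rbrakk> \<Longrightarrow> inv x = y"
  (is "_ \<Longrightarrow> _ \<Longrightarrow> _ \<Longrightarrow> _ \<Longrightarrow> ?thesis")
proof -
  assume a: "x \<in> carrier S" "y \<in> carrier S" "x \<cdot> (y \<cdot> x) = x" "y \<cdot> (x \<cdot> y) = y"
  have "is_inverse S x y" using a by (simp add: is_inverse_def mul_assoc)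
  then show ?thesis using ex1_inverse[OF a(1)] inv_is_inverse[OF a(1)] by blast
qed

lemma inv_inv [simp]: "x \<in> carrier S \<Longrightarrow> inv (inv x) = x"
  by (rule inv_unique) (auto simp: inv_l inv_r)

lemma idems_closed [simp]: "e \<in> idems S \<Longrightarrow> e \<in> carrier S"
  by (simp add: idems_def)

lemma idem_mul [simp]: "e \<in> idems S \<Longrightarrow> e \<cdot> e = e"
  unfolding idems_def by blast

lemma idemsI: "e \<in> carrier S \<Longrightarrow> e \<cdot> e = e \<Longrightarrow> e \<in> idems S"
  unfolding idems_def by blast

lemma idem_mul2 [simp]: "e \<in> idems S \<Longrightarrow> z \<in> carrier S \<Longrightarrow> e \<cdot> (e \<cdot> z) = e \<cdot> z"
  using mul_assoc[of e e z] by simp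

lemma idem_inv [simp]: "e \<in> idems S \<Longrightarrow> inv e = e"
  by (rule inv_unique) auto

lemma idems_mul_closed [simp]:
  assumes e: "e \<in> idems S" and f: "f \<in> idems S"
  shows "e \<cdot> f \<in> idems S"
proof -
  define x where "x = inv (e \<cdot> f)"
  have c: "e \<in> carrier S" "f \<in> carrier S" "x \<in> carrier S"
    using e f by (auto simp: x_def)
  have x1: "e \<cdot> (f \<cdot> (x \<cdot> (e \<cdot> f))) = e \<cdot> f"
    using inv_l[of "e \<cdot> f"] c by (simp add: x_def[symmetric] mul_assoc)
  have x2: "x \<cdot> (e \<cdot> (f \<cdot> x)) = x"
    using inv_r[of "e \<cdot> f"] c by (simp add: x_def[symmetric] mul_assoc)
  have x2': "x \<cdot> (e \<cdot> (f \<cdot> (x \<cdot> z))) = x \<cdot> z" if "z \<in> carrier S" for z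
  proof -
    have "x \<cdot> (e \<cdot> (f \<cdot> (x \<cdot> z))) = (x \<cdot> (e \<cdot> (f \<cdot> x))) \<cdot> z"
      using that c by (simp add: mul_assoc)
    then show ?thesis by (simp add: x2)
  qed
  have "inv (e \<cdot> f) = f \<cdot> (x \<cdot> e)"
    by (rule inv_unique; use c e f x1 x2' in \<open>simp add: mul_assoc\<close>)
  then have x3: "x = f \<cdot> (x \<cdot> e)" by (simp only: x_def[symmetric])
  have "x \<cdot> x = f \<cdot> (x \<cdot> (e \<cdot> (f \<cdot> (x \<cdot> e))))"
    using c by (subst (1 2) x3) (simp add: mul_assoc)
  also have "\<dots> = f \<cdot> (x \<cdot> e)"
    using c x2' by simp
  also have "\<dots> = x" by (simp only: x3[symmetric])
  finally have "x \<cdot> x = x" .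
  then have "x \<in> idems S" using c by (intro idemsI)
  then have "inv x = x" by simp
  moreover have "inv x = e \<cdot> f" using c by (simp add: x_def)
  ultimately show ?thesis using \<open>x \<in> idems S\<close> by simp
qed

lemma idems_comm:
  assumes e: "e \<in> idems S" and f: "f \<in> idems S"
  shows "e \<cdot> f = f \<cdot> e"
proof -
  have ef: "e \<cdot> f \<in> idems S" "f \<cdot> e \<in> idems S" using e f by auto
  have c: "e \<in> carrier S" "f \<in> carrier S" using e f by auto
  have a: "e \<cdot> (f \<cdot> (e \<cdot> f)) = e \<cdot> f" "f \<cdot> (e \<cdot> (f \<cdot> e)) = f \<cdot> e"
    using idem_mul[OF ef(1)] idem_mul[OF ef(2)] c by (auto simp: mul_assoc)
  have "inv (e \<cdot> f) = f \<cdot> e"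
    by (rule inv_unique; use c e f a in \<open>simp add: mul_assoc\<close>)
  then show ?thesis using ef by simp
qed

lemma idems_lcomm: "\<lbrakk>e \<in> idems S; f \<in> idems S; z \<in> carrier S\<rbrakk> \<Longrightarrow> e \<cdot> (f \<cdot> z) = f \<cdot> (e \<cdot> z)"
  using mul_assoc[of e f z] mul_assoc[of f e z] idems_comm[of e f] by simp

lemma d_idems [simp]: "x \<in> carrier S \<Longrightarrow> d_idem S x \<in> idems S"
  by (rule idemsI) (simp_all add: d_idem_def mul_assoc inv_r2)

lemma r_idems [simp]: "x \<in> carrier S \<Longrightarrow> r_idem S x \<in> idems S"
  by (rule idemsI) (simp_all add: r_idem_def mul_assoc inv_l2)

lemma d_closed [simp]: "x \<in> carrier S \<Longrightarrow> d_idem S x \<in> carrier S"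
  and r_closed [simp]: "x \<in> carrier S \<Longrightarrow> r_idem S x \<in> carrier S"
  by (simp_all add: d_idem_def r_idem_def)

lemma mul_d: "x \<in> carrier S \<Longrightarrow> x \<cdot> d_idem S x = x"
  by (simp add: d_idem_def inv_l)

lemma r_mul: "x \<in> carrier S \<Longrightarrow> r_idem S x \<cdot> x = x"
  by (simp add: r_idem_def mul_assoc inv_l)

lemma inv_mul:
  assumes c: "x \<in> carrier S" "y \<in> carrier S"
  shows "inv (x \<cdot> y) = inv y \<cdot> inv x"
proof (rule inv_unique)
  have i: "inv x \<cdot> x \<in> idems S" "y \<cdot> inv y \<in> idems S"
    using d_idems[OF c(1)] r_idems[OF c(2)] by (auto simp: d_idem_def r_idem_def)
  have k: "y \<cdot> (inv y \<cdot> (inv x \<cdot> (x \<cdot> z))) = inv x \<cdot> (x \<cdot> (y \<cdot> (inv y \<cdot> z)))"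
    if "z \<in> carrier S" for z
    using idems_lcomm[OF i(2) i(1) that] c that by (simp add: mul_assoc)
  show "x \<cdot> y \<cdot> (inv y \<cdot> inv x \<cdot> (x \<cdot> y)) = x \<cdot> y"
    using c by (simp add: mul_assoc k inv_l inv_l2)
  have k': "inv x \<cdot> (x \<cdot> (y \<cdot> (inv y \<cdot> z))) = y \<cdot> (inv y \<cdot> (inv x \<cdot> (x \<cdot> z)))"
    if "z \<in> carrier S" for z
    using k that by simp
  show "inv y \<cdot> inv x \<cdot> (x \<cdot> y \<cdot> (inv y \<cdot> inv x)) = inv y \<cdot> inv x"
    using c by (simp add: mul_assoc k' inv_r inv_r2)
qed (use c in auto)

subsection \<open>The natural ordering\<close>

lemma nat_order_simps [simp]:
  "carrier (nat_order S) = carrier S" "eq (nat_order S) = (=)"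
  by (simp_all add: nat_order_def)

lemma idem_order_simps [simp]:
  "carrier (idem_order S) = idems S" "eq (idem_order S) = (=)"
  "le (idem_order S) = le (nat_order S)"
  by (simp_all add: idem_order_def nat_order_def)

lemma le_iff:
  "\<lbrakk>x \<in> carrier S; y \<in> carrier S\<rbrakk> \<Longrightarrow> x \<sqsubseteq>\<^bsub>nat_order S\<^esub> y \<longleftrightarrow> x = y \<cdot> d_idem S x"
  by (simp add: nat_order_def d_idem_def mul_assoc)

lemma leI:
  assumes c: "y \<in> carrier S" "e \<in> idems S" and x: "x = y \<cdot> e"
  shows "x \<sqsubseteq>\<^bsub>nat_order S\<^esub> y"
proof -
  have xc: "x \<in> carrier S" using c x by auto
  have "d_idem S x = e \<cdot> d_idem S y \<cdot> e"
    using c x by (simp add: d_idem_def inv_mul mul_assoc)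
  then have "d_idem S x = d_idem S y \<cdot> e"
    using c idems_comm[of e "d_idem S y"] by (simp add: mul_assoc)
  then have "y \<cdot> d_idem S x = x"
    using c x mul_d[of y] by (metis d_closed idems_closed mul_assoc)
  then show ?thesis using le_iff xc c by simp
qed

lemma nat_le_refl: "x \<in> carrier S \<Longrightarrow> x \<sqsubseteq>\<^bsub>nat_order S\<^esub> x"
  by (simp add: le_iff mul_d)

lemma nat_le_antisym:
  assumes "x \<in> carrier S" "y \<in> carrier S" "x \<sqsubseteq>\<^bsub>nat_order S\<^esub> y" "y \<sqsubseteq>\<^bsub>nat_order S\<^esub> x"
  shows "x = y"
proof -
  have a: "x = y \<cdot> d_idem S x" "y = x \<cdot> d_idem S y" using assms by (simp_all add: le_iff)
  have "x = x \<cdot> d_idem S y \<cdot> d_idem S x" using a by simp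
  also have "\<dots> = x \<cdot> d_idem S x \<cdot> d_idem S y"
    using assms by (simp add: mul_assoc idems_comm[of "d_idem S x"])
  also have "\<dots> = y" using a assms by (simp add: mul_d)
  finally show ?thesis .
qed

lemma nat_le_trans:
  assumes "x \<in> carrier S" "y \<in> carrier S" "z \<in> carrier S"
    "x \<sqsubseteq>\<^bsub>nat_order S\<^esub> y" "y \<sqsubseteq>\<^bsub>nat_order S\<^esub> z"
  shows "x \<sqsubseteq>\<^bsub>nat_order S\<^esub> z"
proof (rule leI)
  have a: "x = y \<cdot> d_idem S x" "y = z \<cdot> d_idem S y" using assms by (simp_all add: le_iff)
  have "x = z \<cdot> d_idem S y \<cdot> d_idem S x" using a by simp
  then show "x = z \<cdot> (d_idem S y \<cdot> d_idem S x)" using assms by (simp add: mul_assoc)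
qed (use assms in auto)

lemma nat_partial_order: "partial_order (nat_order S)"
  by unfold_locales (auto intro: nat_le_refl nat_le_antisym nat_le_trans)

lemma idem_partial_order: "partial_order (idem_order S)"
  by unfold_locales
     (auto intro: nat_le_refl nat_le_antisym
        nat_le_trans[OF idems_closed idems_closed idems_closed])

lemma idem_d [simp]: "e \<in> idems S \<Longrightarrow> d_idem S e = e"
  and idem_r [simp]: "e \<in> idems S \<Longrightarrow> r_idem S e = e"
  by (simp_all add: d_idem_def r_idem_def)

lemma idem_le_iff: "\<lbrakk>e \<in> idems S; f \<in> idems S\<rbrakk> \<Longrightarrow> e \<sqsubseteq>\<^bsub>nat_order S\<^esub> f \<longleftrightarrow> e = f \<cdot> e"
  by (simp add: le_iff)

lemma le_idem: "\<lbrakk>x \<in> carrier S; e \<in> idems S; x \<sqsubseteq>\<^bsub>nat_order S\<^esub> e\<rbrakk> \<Longrightarrow> x \<in> idems S"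
  by (metis d_idems idems_closed idems_mul_closed le_iff)

lemma idem_glb:
  assumes "e \<in> idems S" "f \<in> idems S"
  shows "is_glb (idem_order S) (e \<cdot> f) {e, f}"
proof (rule greatest_LowerI)
  fix x assume "x \<in> {e, f}"
  then show "e \<cdot> f \<sqsubseteq>\<^bsub>idem_order S\<^esub> x"
    using assms by (auto simp: idem_le_iff idems_lcomm[of f e])
next
  fix y assume "y \<in> Lower (idem_order S) {e, f}"
  then have y: "y \<in> idems S" "y \<sqsubseteq>\<^bsub>nat_order S\<^esub> e" "y \<sqsubseteq>\<^bsub>nat_order S\<^esub> f"
    using assms by (auto simp: Lower_def)
  then have "y = e \<cdot> y" "y = f \<cdot> y" using assms by (auto simp: idem_le_iff)
  then have "y = e \<cdot> f \<cdot> y" using assms y by (metis idems_closed mul_assoc)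
  then show "y \<sqsubseteq>\<^bsub>idem_order S\<^esub> e \<cdot> f" using assms y by (simp add: idem_le_iff)
qed (use assms in auto)

lemma idem_meet:
  assumes "e \<in> idems S" "f \<in> idems S"
  shows "e \<sqinter>\<^bsub>idem_order S\<^esub> f = e \<cdot> f"
proof -
  interpret E: partial_order "idem_order S" by (rule idem_partial_order)
  have "is_glb (idem_order S) (e \<sqinter>\<^bsub>idem_order S\<^esub> f) {e, f}"
    unfolding meet_def inf_def by (rule someI) (rule idem_glb[OF assms])
  then show ?thesis
    using E.weak_greatest_unique[OF _ idem_glb[OF assms]] by simp
qed

lemma join_eqI:
  assumes "is_lub (nat_order S) s {x, y}"
  shows "x \<oplus> y = s"
proof -
  interpret E: partial_order "nat_order S" by (rule nat_partial_order)
  have "is_lub (nat_order S) (x \<oplus> y) {x, y}"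
    unfolding osum_def join_def sup_def by (rule someI) (rule assms)
  then show ?thesis
    using E.weak_least_unique[OF _ assms] by simp
qed

lemma idem_join_eqI:
  assumes "is_lub (idem_order S) s {x, y}"
  shows "x \<squnion>\<^bsub>idem_order S\<^esub> y = s"
proof -
  interpret E: partial_order "idem_order S" by (rule idem_partial_order)
  have "is_lub (idem_order S) (x \<squnion>\<^bsub>idem_order S\<^esub> y) {x, y}"
    unfolding join_def sup_def by (rule someI) (rule assms)
  then show ?thesis
    using E.weak_least_unique[OF _ assms] by simp
qed

end

lemma (in inverse_semigroup) hom_inv:
  assumes "inverse_semigroup T" "f \<in> semigroup_hom S T" "x \<in> carrier S"
  shows "f (inv x) = inv\<^bsub>T\<^esub> (f x)"
proof -
  interpret T: inverse_semigroup T by fact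
  have h: "f a \<in> carrier T" "f (a \<cdot> b) = f a \<cdot>\<^bsub>T\<^esub> f b" if "a \<in> carrier S" "b \<in> carrier S" for a b
    using assms that by (auto simp: semigroup_hom_def)
  show ?thesis
    by (rule T.inv_unique[symmetric])
       (use assms h inv_l[of x] inv_r[of x] in \<open>simp_all add: h(2)[symmetric]\<close>)
qed


context generalized_boolean_algebra
begin

lemma le_meet_eq: "\<lbrakk>x \<in> carrier L; y \<in> carrier L; x \<sqsubseteq> y\<rbrakk> \<Longrightarrow> x \<sqinter> y = x"
  by (rule le_antisym) (auto intro: meet_left meet_le meet_closed)

lemma join_bottom: "x \<in> carrier L \<Longrightarrow> x \<squnion> \<bottom> = x"
  by (rule le_antisym) (auto intro!: join_left join_le join_closed bottom_lower)

lemma complement_unique: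
  assumes c: "z \<in> carrier L" "w \<in> carrier L" "x \<in> carrier L" "y \<in> carrier L"
    and "z \<sqinter> x = \<bottom>" "z \<squnion> x = y" "w \<sqinter> x = \<bottom>" "w \<squnion> x = y"
  shows "z = w"
proof -
  have *: "a = a \<sqinter> b"
    if "a \<in> carrier L" "b \<in> carrier L" "a \<sqinter> x = \<bottom>" "a \<squnion> x = y" "b \<squnion> x = y" for a b
  proof -
    have "a = a \<sqinter> y" using le_meet_eq[of a y] join_left[of a x] that c by simp
    also have "\<dots> = (a \<sqinter> b) \<squnion> (a \<sqinter> x)"
      using that c meet_join_distrib[of a b x] by simp
    also have "\<dots> = a \<sqinter> b" using that c by (simp add: join_bottom meet_closed)
    finally show ?thesis .
  qed
  show ?thesis using *[of z w] *[of w z] assms by (simp add: meet_comm)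
qed

lemma rel_diff_spec:
  assumes "x \<in> carrier L" "y \<in> carrier L"
  shows "rel_diff L x y \<in> carrier L \<and> rel_diff L x y \<sqinter> (x \<sqinter> y) = \<bottom> \<and>
    rel_diff L x y \<squnion> (x \<sqinter> y) = x"
proof -
  have m: "x \<sqinter> y \<in> carrier L" "x \<sqinter> y \<sqsubseteq> x" using assms by (auto intro: meet_left meet_closed)
  then obtain z where z: "z \<in> carrier L" "z \<sqinter> (x \<sqinter> y) = \<bottom>" "z \<squnion> (x \<sqinter> y) = x"
    using relative_complement assms by blast
  show ?thesis
    unfolding rel_diff_def
  proof (rule theI[where a = z])
    fix w assume "w \<in> carrier L \<and> w \<sqinter> (x \<sqinter> y) = \<bottom> \<and> w \<squnion> (x \<sqinter> y) = x"
    then show "w = z" using complement_unique[of w z "x \<sqinter> y" x] z m(1) assms(1) by blast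
  qed (use z in blast)
qed

lemma rel_diff_unique:
  assumes "x \<in> carrier L" "y \<in> carrier L" "z \<in> carrier L" "z \<sqinter> (x \<sqinter> y) = \<bottom>" "z \<squnion> (x \<sqinter> y) = x"
  shows "rel_diff L x y = z"
  using complement_unique[of "rel_diff L x y" z "x \<sqinter> y" x] rel_diff_spec[of x y] assms
  by (simp add: meet_closed)

end

context bias
begin

interpretation E: generalized_boolean_algebra "idem_order S"
  by (rule idems_gba)

lemma zero_is_zero: "is_zero S \<zero>"
proof -
  obtain z where z: "is_zero S z" using zero_exists by blast
  show ?thesis
    unfolding zero_def
    by (rule theI[where P = "is_zero S", OF z]) (use z in \<open>unfold is_zero_def, metis\<close>)
qed

lemma zero_closed [simp]: "\<zero> \<in> carrier S"
  and zero_r [simp]: "x \<in> carrier S \<Longrightarrow> x \<cdot> \<zero> = \<zero>"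
  and zero_l [simp]: "x \<in> carrier S \<Longrightarrow> \<zero> \<cdot> x = \<zero>"
  using zero_is_zero by (auto simp: is_zero_def)

lemma zero_idem [simp]: "\<zero> \<in> idems S"
  by (rule idemsI) auto

lemma bottom_eq: "\<bottom>\<^bsub>idem_order S\<^esub> = \<zero>"
proof (rule E.le_antisym)
  show "\<bottom>\<^bsub>idem_order S\<^esub> \<sqsubseteq>\<^bsub>idem_order S\<^esub> \<zero>" by (rule E.bottom_lower) simp
  show "\<zero> \<sqsubseteq>\<^bsub>idem_order S\<^esub> \<bottom>\<^bsub>idem_order S\<^esub>"
    using E.bottom_closed by (simp add: idem_le_iff)
qed (use E.bottom_closed in auto)

lemma diff_idem [simp]: "\<lbrakk>e \<in> idems S; f \<in> idems S\<rbrakk> \<Longrightarrow> rel_diff (idem_order S) e f \<in> idems S"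
  using E.rel_diff_spec[of e f] by simp

lemma diff_mul: "\<lbrakk>e \<in> idems S; f \<in> idems S\<rbrakk> \<Longrightarrow> rel_diff (idem_order S) e f \<cdot> (e \<cdot> f) = \<zero>"
  using E.rel_diff_spec[of e f] by (simp add: idem_meet bottom_eq)

lemma diff_join:
  "\<lbrakk>e \<in> idems S; f \<in> idems S\<rbrakk> \<Longrightarrow> rel_diff (idem_order S) e f \<squnion>\<^bsub>idem_order S\<^esub> (e \<cdot> f) = e"
  using E.rel_diff_spec[of e f] by (simp add: idem_meet)

lemma diff_unique:
  "\<lbrakk>e \<in> idems S; f \<in> idems S; g \<in> idems S; g \<cdot> (e \<cdot> f) = \<zero>; g \<squnion>\<^bsub>idem_order S\<^esub> (e \<cdot> f) = e\<rbrakk>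
    \<Longrightarrow> rel_diff (idem_order S) e f = g"
  using E.rel_diff_unique[of e f g] by (simp add: idem_meet bottom_eq)

lemma diff_le:
  assumes "e \<in> idems S" "f \<in> idems S"
  shows "e \<cdot> rel_diff (idem_order S) e f = rel_diff (idem_order S) e f"
  using E.join_left[of "rel_diff (idem_order S) e f" "e \<cdot> f"] assms
  by (simp add: diff_join idem_le_iff)

lemma diff_orth:
  assumes "e \<in> idems S" "f \<in> idems S"
  shows "rel_diff (idem_order S) e f \<cdot> f = \<zero>"
proof -
  have "rel_diff (idem_order S) e f \<cdot> f = rel_diff (idem_order S) e f \<cdot> e \<cdot> f"
    using diff_le[OF assms] idems_comm[of e "rel_diff (idem_order S) e f"] assms by simp
  then show ?thesis using diff_mul[OF assms] assms by (simp add: mul_assoc)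
qed

lemma diff_disjoint: "\<lbrakk>e \<in> idems S; f \<in> idems S; e \<cdot> f = \<zero>\<rbrakk> \<Longrightarrow> rel_diff (idem_order S) e f = e"
  using E.join_bottom[of e] by (intro diff_unique) (auto simp: bottom_eq)

lemma inv_zero [simp]: "inv \<zero> = \<zero>"
  by simp

lemma orthogonal_iff:
  assumes c: "x \<in> carrier S" "y \<in> carrier S"
  shows "orthogonal S x y \<longleftrightarrow>
    r_idem S x \<cdot> r_idem S y = \<zero> \<and> d_idem S x \<cdot> d_idem S y = \<zero>"
proof
  assume o: "orthogonal S x y"
  have "r_idem S x \<cdot> r_idem S y = x \<cdot> (inv x \<cdot> y) \<cdot> inv y"
    "d_idem S x \<cdot> d_idem S y = inv x \<cdot> (x \<cdot> inv y) \<cdot> y"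
    using c by (simp_all add: r_idem_def d_idem_def mul_assoc)
  then show "r_idem S x \<cdot> r_idem S y = \<zero> \<and> d_idem S x \<cdot> d_idem S y = \<zero>"
    using o c by (simp add: orthogonal_def)
next
  assume o: "r_idem S x \<cdot> r_idem S y = \<zero> \<and> d_idem S x \<cdot> d_idem S y = \<zero>"
  have "inv x \<cdot> y = inv x \<cdot> (r_idem S x \<cdot> r_idem S y) \<cdot> y"
    "x \<cdot> inv y = x \<cdot> (d_idem S x \<cdot> d_idem S y) \<cdot> inv y"
    using c by (simp_all add: r_idem_def d_idem_def mul_assoc inv_l inv_r inv_l2 inv_r2)
  then show "orthogonal S x y" using o c by (simp add: orthogonal_def)
qed

lemma osum_lub:
  "\<lbrakk>x \<in> carrier S; y \<in> carrier S; orthogonal S x y\<rbrakk> \<Longrightarrow> is_lub (nat_order S) (x \<oplus> y) {x, y}"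
  using orthogonal_join join_eqI by metis

lemma osum_closed [simp]:
  "\<lbrakk>x \<in> carrier S; y \<in> carrier S; orthogonal S x y\<rbrakk> \<Longrightarrow> x \<oplus> y \<in> carrier S"
  using osum_lub[of x y] by (metis least_closed nat_order_simps(1))

lemma osum_idem:
  assumes c: "e \<in> idems S" "f \<in> idems S" and o: "e \<cdot> f = \<zero>"
  shows "e \<oplus> f = e \<squnion>\<^bsub>idem_order S\<^esub> f"
proof -
  let ?j = "e \<squnion>\<^bsub>idem_order S\<^esub> f"
  have orth: "orthogonal S e f" using c o by (simp add: orthogonal_iff)
  have l: "is_lub (nat_order S) (e \<oplus> f) {e, f}" using osum_lub orth c by simp
  have j: "?j \<in> idems S" using E.join_closed[of e f] c by simp
  have up: "e \<sqsubseteq>\<^bsub>nat_order S\<^esub> ?j" "f \<sqsubseteq>\<^bsub>nat_order S\<^esub> ?j"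
    using E.join_left[of e f] E.join_right[of e f] c by simp_all
  have 1: "e \<oplus> f \<sqsubseteq>\<^bsub>nat_order S\<^esub> ?j"
    by (rule least_le[OF l]) (use up c j in \<open>auto simp: Upper_def\<close>)
  then have i: "e \<oplus> f \<in> idems S"
    using le_idem[of "e \<oplus> f" ?j] c orth j by simp
  have "?j \<sqsubseteq>\<^bsub>nat_order S\<^esub> e \<oplus> f"
    using E.join_le[of e "e \<oplus> f" f] least_Upper_above[OF l, of e] least_Upper_above[OF l, of f] i c
    by simp
  then show ?thesis using 1 nat_le_antisym i j by simp
qed

lemma skew_diff_closed [simp]: "\<lbrakk>x \<in> carrier S; y \<in> carrier S\<rbrakk> \<Longrightarrow> x \<ominus> y \<in> carrier S"
  by (simp add: skew_diff_def)

lemma skew_diff_orthogonal: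
  assumes c: "x \<in> carrier S" "y \<in> carrier S"
  shows "orthogonal S (x \<ominus> y) y"
proof -
  define R where "R = rel_diff (idem_order S) (r_idem S x) (r_idem S y)"
  define D where "D = rel_diff (idem_order S) (d_idem S x) (d_idem S y)"
  have i: "R \<in> idems S" "D \<in> idems S" using c by (simp_all add: R_def D_def)
  have z: "R \<cdot> r_idem S y = \<zero>" "D \<cdot> d_idem S y = \<zero>"
    using c by (simp_all add: R_def D_def diff_orth)
  have Ry: "R \<cdot> y = \<zero>"
    using z(1) mul_assoc[of R "r_idem S y" y] i c by (simp add: r_mul)
  have "D \<cdot> inv y = D \<cdot> (d_idem S y \<cdot> inv y)"
    using c i by (simp add: d_idem_def mul_assoc inv_r)
  then have Dy: "D \<cdot> inv y = \<zero>"
    using z(2) mul_assoc[of D "d_idem S y" "inv y"] i c by simp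
  have "x \<ominus> y = R \<cdot> x \<cdot> D" by (simp add: skew_diff_def R_def D_def)
  then show ?thesis
    using c i by (simp add: orthogonal_def inv_mul mul_assoc Ry Dy)
qed

lemma skew_add_closed [simp]: "\<lbrakk>x \<in> carrier S; y \<in> carrier S\<rbrakk> \<Longrightarrow> x \<nabla> y \<in> carrier S"
  by (simp add: skew_add_def skew_diff_orthogonal)

lemma skew_add_orthogonal:
  assumes "x \<in> carrier S" "y \<in> carrier S" "orthogonal S x y"
  shows "x \<nabla> y = x \<oplus> y"
proof -
  have "x \<ominus> y = x"
    using assms by (simp add: skew_diff_def orthogonal_iff diff_disjoint r_mul mul_d)
  then show ?thesis by (simp add: skew_add_def)
qed

lemma skew_diff_idem:
  assumes "e \<in> idems S" "f \<in> idems S"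
  shows "e \<ominus> f = rel_diff (idem_order S) e f"
  using assms diff_le[OF assms] by (simp add: skew_diff_def mul_assoc)

lemma skew_add_idem:
  assumes c: "e \<in> idems S" "f \<in> idems S"
  shows "e \<nabla> f = e \<squnion>\<^bsub>idem_order S\<^esub> f"
proof -
  let ?d = "rel_diff (idem_order S) e f"
  have "e \<nabla> f = ?d \<squnion>\<^bsub>idem_order S\<^esub> f"
    using c by (simp add: skew_add_def skew_diff_idem osum_idem diff_orth)
  also have "\<dots> = e \<squnion>\<^bsub>idem_order S\<^esub> f"
  proof (rule E.le_antisym)
    have d: "?d \<sqsubseteq>\<^bsub>idem_order S\<^esub> e"
      using c diff_le by (simp add: idem_le_iff)
    have ef: "e \<cdot> f \<sqsubseteq>\<^bsub>idem_order S\<^esub> f"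
      using c by (simp add: idem_le_iff idems_lcomm[of f e])
    show "?d \<squnion>\<^bsub>idem_order S\<^esub> f \<sqsubseteq>\<^bsub>idem_order S\<^esub> e \<squnion>\<^bsub>idem_order S\<^esub> f"
      using d c E.join_left[of e f] E.join_right[of e f] E.join_closed[of e f]
        E.le_trans[of ?d e "e \<squnion>\<^bsub>idem_order S\<^esub> f"]
      by (intro E.join_le) auto
    have "?d \<squnion>\<^bsub>idem_order S\<^esub> (e \<cdot> f) \<sqsubseteq>\<^bsub>idem_order S\<^esub> ?d \<squnion>\<^bsub>idem_order S\<^esub> f"
      using ef c E.join_left[of ?d f] E.join_right[of ?d f] E.join_closed[of ?d f]
        E.le_trans[of "e \<cdot> f" f "?d \<squnion>\<^bsub>idem_order S\<^esub> f"]
      by (intro E.join_le) auto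
    then show "e \<squnion>\<^bsub>idem_order S\<^esub> f \<sqsubseteq>\<^bsub>idem_order S\<^esub> ?d \<squnion>\<^bsub>idem_order S\<^esub> f"
      using c E.join_right[of ?d f] E.join_closed[of ?d f]
      by (intro E.join_le) (auto simp: diff_join)
  qed (use c E.join_closed[of e f] E.join_closed[of ?d f] in auto)
  finally show ?thesis .
qed

lemma eval_closed:
  "\<lbrakk>f \<in> semigroup_hom A S; t \<in> terms A\<rbrakk> \<Longrightarrow> eval S f t \<in> carrier S"
  by (induction t) (auto simp: terms_def semigroup_hom_def)

end


subsection \<open>Bias homomorphisms preserve the bias operations\<close>

locale bias_hom_pair = S: bias S + T: bias T
  for S :: "'a magma" and T :: "'b magma" and h :: "'a \<Rightarrow> 'b" +
  assumes h: "h \<in> bias_hom S T"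
begin

lemma h_closed [simp]: "x \<in> carrier S \<Longrightarrow> h x \<in> carrier T"
  and h_mul: "\<lbrakk>x \<in> carrier S; y \<in> carrier S\<rbrakk> \<Longrightarrow> h (x \<cdot>\<^bsub>S\<^esub> y) = h x \<cdot>\<^bsub>T\<^esub> h y"
  and h_zero: "h \<zero>\<^bsub>S\<^esub> = \<zero>\<^bsub>T\<^esub>"
  and h_osum: "\<lbrakk>x \<in> carrier S; y \<in> carrier S; orthogonal S x y\<rbrakk> \<Longrightarrow> h (x \<oplus>\<^bsub>S\<^esub> y) = h x \<oplus>\<^bsub>T\<^esub> h y"
  using h by (auto simp: bias_hom_def semigroup_hom_def)

lemma h_inv: "x \<in> carrier S \<Longrightarrow> h (inv\<^bsub>S\<^esub> x) = inv\<^bsub>T\<^esub> (h x)"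
  using S.hom_inv[OF T.inverse_semigroup_axioms] h by (simp add: bias_hom_def)

lemma h_d: "x \<in> carrier S \<Longrightarrow> h (d_idem S x) = d_idem T (h x)"
  and h_r: "x \<in> carrier S \<Longrightarrow> h (r_idem S x) = r_idem T (h x)"
  by (simp_all add: d_idem_def r_idem_def h_mul h_inv)

lemma h_idem [simp]: "e \<in> idems S \<Longrightarrow> h e \<in> idems T"
  by (rule T.idemsI) (simp_all add: h_mul[symmetric])

lemma h_diff:
  assumes c: "e \<in> idems S" "f \<in> idems S"
  shows "h (rel_diff (idem_order S) e f) = rel_diff (idem_order T) (h e) (h f)"
proof (rule T.diff_unique[symmetric])
  let ?d = "rel_diff (idem_order S) e f"
  show z: "h ?d \<cdot>\<^bsub>T\<^esub> (h e \<cdot>\<^bsub>T\<^esub> h f) = \<zero>\<^bsub>T\<^esub>"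
    using c S.diff_mul[OF c] by (simp add: h_mul[symmetric] h_zero)
  have "h ?d \<squnion>\<^bsub>idem_order T\<^esub> (h e \<cdot>\<^bsub>T\<^esub> h f) = h ?d \<oplus>\<^bsub>T\<^esub> (h e \<cdot>\<^bsub>T\<^esub> h f)"
    using c z by (intro T.osum_idem[symmetric]) auto
  also have "\<dots> = h (?d \<oplus>\<^bsub>S\<^esub> (e \<cdot>\<^bsub>S\<^esub> f))"
    using c S.diff_mul[OF c] by (simp add: h_osum h_mul S.orthogonal_iff)
  also have "?d \<oplus>\<^bsub>S\<^esub> (e \<cdot>\<^bsub>S\<^esub> f) = e"
    using c S.diff_mul[OF c] by (simp add: S.osum_idem S.diff_join)
  finally show "h ?d \<squnion>\<^bsub>idem_order T\<^esub> (h e \<cdot>\<^bsub>T\<^esub> h f) = h e" .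
qed (use c in auto)

lemma h_skew_diff:
  "\<lbrakk>x \<in> carrier S; y \<in> carrier S\<rbrakk> \<Longrightarrow> h (x \<ominus>\<^bsub>S\<^esub> y) = h x \<ominus>\<^bsub>T\<^esub> h y"
  by (simp add: skew_diff_def h_mul h_diff h_d h_r)

lemma h_skew_add:
  "\<lbrakk>x \<in> carrier S; y \<in> carrier S\<rbrakk> \<Longrightarrow> h (x \<nabla>\<^bsub>S\<^esub> y) = h x \<nabla>\<^bsub>T\<^esub> h y"
  by (simp add: skew_add_def h_osum S.skew_diff_orthogonal h_skew_diff)

lemma h_eval:
  assumes f: "f \<in> semigroup_hom A S" and t: "t \<in> terms A"
  shows "h (eval S f t) = eval T (h \<circ> f) t"
  using t
proof (induction t)
  case (Gen a) then show ?case by simp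
next
  case Zero then show ?case by (simp add: h_zero)
next
  case (Inv t)
  then have "t \<in> terms A" by (simp add: terms_def)
  then show ?case using Inv S.eval_closed[OF f] by (simp add: h_inv)
next
  case (Mul t u)
  then have "t \<in> terms A" "u \<in> terms A" by (simp_all add: terms_def)
  then show ?case using Mul S.eval_closed[OF f] by (simp add: h_mul)
next
  case (Diff t u)
  then have "t \<in> terms A" "u \<in> terms A" by (simp_all add: terms_def)
  then show ?case using Diff S.eval_closed[OF f] by (simp add: h_skew_diff)
next
  case (Add t u)
  then have "t \<in> terms A" "u \<in> terms A" by (simp_all add: terms_def)
  then show ?case using Add S.eval_closed[OF f] by (simp add: h_skew_add)
qed

end


lemma (in inverse_semigroup) idem_bottom_eq:
  assumes "is_zero S z"
  shows "least (idem_order S) z (idems S)" "\<bottom>\<^bsub>idem_order S\<^esub> = z"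
proof -
  interpret E: partial_order "idem_order S" by (rule idem_partial_order)
  have z: "z \<in> idems S" using assms by (auto simp: is_zero_def intro: idemsI)
  show l: "least (idem_order S) z (idems S)"
    using z assms by (auto simp: least_def idem_le_iff is_zero_def)
  then have "least (idem_order S) \<bottom>\<^bsub>idem_order S\<^esub> (idems S)"
    unfolding bottom_def by (simp add: someI[where P = "\<lambda>x. least (idem_order S) x (idems S)"])
  then show "\<bottom>\<^bsub>idem_order S\<^esub> = z" using E.weak_least_unique[OF _ l] by simp
qed

lemma zero_eqI: "is_zero S z \<Longrightarrow> \<zero>\<^bsub>S\<^esub> = z"
  unfolding zero_def by (rule the_equality) (unfold is_zero_def, metis+)

lemma (in bias) idem_lub:
  assumes "e \<in> idems S" "f \<in> idems S"
  shows "is_lub (idem_order S) (e \<squnion>\<^bsub>idem_order S\<^esub> f) {e, f}"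
proof -
  interpret E: generalized_boolean_algebra "idem_order S" by (rule idems_gba)
  have le: "e \<squnion>\<^bsub>idem_order S\<^esub> f \<sqsubseteq>\<^bsub>idem_order S\<^esub> y"
    if "e \<sqsubseteq>\<^bsub>idem_order S\<^esub> y" "f \<sqsubseteq>\<^bsub>idem_order S\<^esub> y" "y \<in> idems S" for y
    using that assms by (intro E.join_le) auto
  show ?thesis
    by (rule least_UpperI)
       (use assms E.join_left[of e f] E.join_right[of e f] E.join_closed[of e f] le
         in \<open>auto simp: Upper_def\<close>)
qed

lemma bias_hom_comp:
  assumes "bias S" "bias T" "bias W" "g \<in> bias_hom S T" "h \<in> bias_hom T W"
  shows "(\<lambda>x. h (g x)) \<in> bias_hom S W"
proof -
  interpret g: bias_hom_pair S T g
    using assms by (simp add: bias_hom_pair_def bias_hom_pair_axioms_def)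
  interpret h: bias_hom_pair T W h
    using assms by (simp add: bias_hom_pair_def bias_hom_pair_axioms_def)
  have "orthogonal T (g x) (g y)" if "x \<in> carrier S" "y \<in> carrier S" "orthogonal S x y" for x y
    using that by (metis orthogonal_def g.h_inv g.h_mul g.h_zero g.S.inv_closed)
  then show ?thesis
    by (auto simp: bias_hom_def semigroup_hom_def g.h_mul h.h_mul g.h_zero h.h_zero g.h_osum h.h_osum)
qed


subsection \<open>Algebras separated by maps into biases\<close>

text \<open>
  Subalgebras of direct products of biases, with respect to the bias operations, are biases.
\<close>

locale separating =
  fixes U :: "'u magma" (structure) and H :: "('b magma \<times> ('u \<Rightarrow> 'b)) set"
  assumes bias: "(T, h) \<in> H \<Longrightarrow> bias T"
    and h_closed: "\<lbrakk>(T, h) \<in> H; x \<in> carrier U\<rbrakk> \<Longrightarrow> h x \<in> carrier T"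
    and h_mul: "\<lbrakk>(T, h) \<in> H; x \<in> carrier U; y \<in> carrier U\<rbrakk> \<Longrightarrow> h (x \<cdot> y) = h x \<cdot>\<^bsub>T\<^esub> h y"
    and sep: "\<lbrakk>x \<in> carrier U; y \<in> carrier U; \<And>T h. (T, h) \<in> H \<Longrightarrow> h x = h y\<rbrakk> \<Longrightarrow> x = y"
    and mul_cl: "\<lbrakk>x \<in> carrier U; y \<in> carrier U\<rbrakk> \<Longrightarrow> x \<cdot> y \<in> carrier U"
    and zero_ex: "\<exists>z\<in>carrier U. \<forall>(T, h)\<in>H. h z = \<zero>\<^bsub>T\<^esub>"
    and inv_ex: "x \<in> carrier U \<Longrightarrow> \<exists>z\<in>carrier U. \<forall>(T, h)\<in>H. h z = inv\<^bsub>T\<^esub> (h x)"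
    and diff_ex: "\<lbrakk>x \<in> carrier U; y \<in> carrier U\<rbrakk>
      \<Longrightarrow> \<exists>z\<in>carrier U. \<forall>(T, h)\<in>H. h z = h x \<ominus>\<^bsub>T\<^esub> h y"
    and add_ex: "\<lbrakk>x \<in> carrier U; y \<in> carrier U\<rbrakk>
      \<Longrightarrow> \<exists>z\<in>carrier U. \<forall>(T, h)\<in>H. h z = h x \<nabla>\<^bsub>T\<^esub> h y"
begin

lemma T_inverse_semigroup: "(T, h) \<in> H \<Longrightarrow> inverse_semigroup T"
  using bias by (simp add: bias_def)

lemma U_inverse_semigroup: "inverse_semigroup U"
proof
  show "x \<cdot> y \<in> carrier U" if "x \<in> carrier U" "y \<in> carrier U" for x y
    using that by (rule mul_cl)
  show assoc: "x \<cdot> y \<cdot> z = x \<cdot> (y \<cdot> z)" if "x \<in> carrier U" "y \<in> carrier U" "z \<in> carrier U" for x y z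
  proof (rule sep)
    fix T h assume H: "(T, h) \<in> H"
    interpret T: inverse_semigroup T using H by (rule T_inverse_semigroup)
    show "h (x \<cdot> y \<cdot> z) = h (x \<cdot> (y \<cdot> z))"
      using that by (simp add: h_mul[OF H] h_closed[OF H] mul_cl T.mul_assoc)
  qed (use that in \<open>auto intro: mul_cl\<close>)
  show "\<exists>!y. is_inverse U x y" if x: "x \<in> carrier U" for x
  proof -
    obtain z where z: "z \<in> carrier U" "\<And>T h. (T, h) \<in> H \<Longrightarrow> h z = inv\<^bsub>T\<^esub> (h x)"
      using inv_ex[OF x] by blast
    have "x = x \<cdot> z \<cdot> x"
    proof (rule sep)
      fix T h assume H: "(T, h) \<in> H"
      interpret T: inverse_semigroup T using H by (rule T_inverse_semigroup)
      show "h x = h (x \<cdot> z \<cdot> x)"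
        using x z by (simp add: h_mul[OF H] h_closed[OF H] mul_cl T.mul_assoc z(2)[OF H] T.inv_l)
    qed (use x z in \<open>auto intro: mul_cl\<close>)
    moreover have "z = z \<cdot> x \<cdot> z"
    proof (rule sep)
      fix T h assume H: "(T, h) \<in> H"
      interpret T: inverse_semigroup T using H by (rule T_inverse_semigroup)
      show "h z = h (z \<cdot> x \<cdot> z)"
        using x z by (simp add: h_mul[OF H] h_closed[OF H] mul_cl T.mul_assoc z(2)[OF H] T.inv_r)
    qed (use x z in \<open>auto intro: mul_cl\<close>)
    ultimately have "is_inverse U x z" using z(1) unfolding is_inverse_def by blast
    moreover have "w = z" if "is_inverse U x w" for w
    proof (rule sep)
      have w: "w \<in> carrier U" "x \<cdot> (w \<cdot> x) = x" "w \<cdot> (x \<cdot> w) = w"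
        using that x assoc unfolding is_inverse_def by metis+
      show "w \<in> carrier U" by fact
      fix T h assume H: "(T, h) \<in> H"
      interpret T: inverse_semigroup T using H by (rule T_inverse_semigroup)
      have "inv\<^bsub>T\<^esub> (h x) = h w"
        by (rule T.inv_unique)
           (use w x in \<open>simp_all add: h_closed[OF H] h_mul[OF H, symmetric] mul_cl\<close>)
      then show "h w = h z" by (simp add: z(2)[OF H])
    qed (rule z(1))
    ultimately show ?thesis by blast
  qed
qed

sublocale U: inverse_semigroup U
  by (rule U_inverse_semigroup)

lemma h_hom: "(T, h) \<in> H \<Longrightarrow> h \<in> semigroup_hom U T"
  by (auto simp: semigroup_hom_def h_closed h_mul)

lemma h_inv: "(T, h) \<in> H \<Longrightarrow> x \<in> carrier U \<Longrightarrow> h (inv x) = inv\<^bsub>T\<^esub> (h x)"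
  using U.hom_inv[OF T_inverse_semigroup h_hom] .

lemma U_idemI:
  assumes "x \<in> carrier U" "\<And>T h. (T, h) \<in> H \<Longrightarrow> h x \<in> idems T"
  shows "x \<in> idems U"
proof (rule U.idemsI[OF assms(1)], rule sep)
  fix T h assume H: "(T, h) \<in> H"
  interpret T: inverse_semigroup T using H by (rule T_inverse_semigroup)
  show "h (x \<cdot> x) = h x" using assms(2)[OF H] assms(1) by (simp add: h_mul[OF H])
qed (use assms in auto)

lemma h_idem: "(T, h) \<in> H \<Longrightarrow> e \<in> idems U \<Longrightarrow> h e \<in> idems T"
  using T_inverse_semigroup[of T h] h_mul[of T h e e] h_closed[of T h e]
  by (intro inverse_semigroup.idemsI) auto

lemma U_le_iff:
  assumes "x \<in> carrier U" "y \<in> carrier U"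
  shows "x \<sqsubseteq>\<^bsub>nat_order U\<^esub> y \<longleftrightarrow> (\<forall>(T, h)\<in>H. h x \<sqsubseteq>\<^bsub>nat_order T\<^esub> h y)"
proof -
  have "h (y \<cdot> inv x \<cdot> x) = h y \<cdot>\<^bsub>T\<^esub> inv\<^bsub>T\<^esub> (h x) \<cdot>\<^bsub>T\<^esub> h x" if "(T, h) \<in> H" for T h
    using assms by (simp add: h_mul[OF that] h_inv[OF that])
  moreover have "x = y \<cdot> inv x \<cdot> x \<longleftrightarrow> (\<forall>(T, h)\<in>H. h x = h (y \<cdot> inv x \<cdot> x))"
    using sep[of x "y \<cdot> inv x \<cdot> x"] assms by auto
  ultimately show ?thesis by (auto simp: nat_order_def)
qed

lemma U_lubI:
  assumes c: "x \<in> carrier U" "y \<in> carrier U" "s \<in> carrier U"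
    and l: "\<And>T h. (T, h) \<in> H \<Longrightarrow> is_lub (nat_order T) (h s) {h x, h y}"
  shows "is_lub (nat_order U) s {x, y}"
proof (rule least_UpperI)
  fix a assume "a \<in> {x, y}"
  then have a: "a \<in> carrier U" "a = x \<or> a = y" using c by auto
  have "h a \<sqsubseteq>\<^bsub>nat_order T\<^esub> h s" if "(T, h) \<in> H" for T h
    using least_Upper_above[OF l[OF that]] a c h_closed[OF that]
    by (auto simp: inverse_semigroup.nat_order_simps[OF T_inverse_semigroup[OF that]])
  then show "a \<sqsubseteq>\<^bsub>nat_order U\<^esub> s" using a c by (auto simp: U_le_iff)
next
  fix u assume "u \<in> Upper (nat_order U) {x, y}"
  then have u: "u \<in> carrier U" "x \<sqsubseteq>\<^bsub>nat_order U\<^esub> u" "y \<sqsubseteq>\<^bsub>nat_order U\<^esub> u"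
    using c by (auto simp: Upper_def)
  have "h s \<sqsubseteq>\<^bsub>nat_order T\<^esub> h u" if "(T, h) \<in> H" for T h
    by (rule least_le[OF l[OF that]])
       (use u c that h_closed[OF that] in \<open>auto simp: Upper_def U_le_iff
         inverse_semigroup.nat_order_simps[OF T_inverse_semigroup[OF that]]\<close>)
  then show "s \<sqsubseteq>\<^bsub>nat_order U\<^esub> u" using u c by (auto simp: U_le_iff)
qed (use c in auto)

lemma U_idem_lubI:
  assumes c: "x \<in> idems U" "y \<in> idems U" "s \<in> idems U"
    and l: "\<And>T h. (T, h) \<in> H \<Longrightarrow> is_lub (idem_order T) (h s) {h x, h y}"
  shows "is_lub (idem_order U) s {x, y}"
proof (rule least_UpperI)
  fix a assume "a \<in> {x, y}"
  then have a: "a \<in> idems U" "a = x \<or> a = y" using c by auto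
  have "h a \<sqsubseteq>\<^bsub>nat_order T\<^esub> h s" if "(T, h) \<in> H" for T h
    using least_Upper_above[OF l[OF that], of "h a"] a c h_idem[OF that]
    by (auto simp: inverse_semigroup.idem_order_simps[OF T_inverse_semigroup[OF that]])
  then show "a \<sqsubseteq>\<^bsub>idem_order U\<^esub> s" using a c by (auto simp: U_le_iff)
next
  fix u assume "u \<in> Upper (idem_order U) {x, y}"
  then have u: "u \<in> idems U" "x \<sqsubseteq>\<^bsub>nat_order U\<^esub> u" "y \<sqsubseteq>\<^bsub>nat_order U\<^esub> u"
    using c by (auto simp: Upper_def)
  have "h s \<sqsubseteq>\<^bsub>idem_order T\<^esub> h u" if "(T, h) \<in> H" for T h
    by (rule least_le[OF l[OF that]])
       (use u c that h_idem[OF that] in \<open>auto simp: Upper_def U_le_iff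
         inverse_semigroup.idem_order_simps[OF T_inverse_semigroup[OF that]]\<close>)
  then show "s \<sqsubseteq>\<^bsub>idem_order U\<^esub> u"
    using u c
    by (auto simp: U_le_iff inverse_semigroup.idem_order_simps[OF T_inverse_semigroup])
qed (use c in auto)

lemma U_zero: "is_zero U \<zero>" and h_zero: "(T, h) \<in> H \<Longrightarrow> h \<zero> = \<zero>\<^bsub>T\<^esub>"
proof -
  obtain z where z: "z \<in> carrier U" "\<And>T h. (T, h) \<in> H \<Longrightarrow> h z = \<zero>\<^bsub>T\<^esub>"
    using zero_ex by blast
  have hz: "h (x \<cdot> z) = h z \<and> h (z \<cdot> x) = h z" if x: "x \<in> carrier U" and H: "(T, h) \<in> H" for x T h
  proof -
    interpret T: bias T using H by (rule bias)
    show ?thesis using x z(1) h_closed[OF H x] by (simp add: h_mul[OF H] z(2)[OF H])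
  qed
  have "x \<cdot> z = z" "z \<cdot> x = z" if "x \<in> carrier U" for x
    by (rule sep; use z(1) that hz in auto)+
  then have iz: "is_zero U z" using z by (simp add: is_zero_def)
  then show "is_zero U \<zero>" using zero_eqI by metis
  show "h \<zero> = \<zero>\<^bsub>T\<^esub>" if "(T, h) \<in> H" using zero_eqI[OF iz] z that by simp
qed

lemma U_orthogonal_lub:
  assumes c: "x \<in> carrier U" "y \<in> carrier U" and o: "orthogonal U x y"
  obtains s where "s \<in> carrier U" "is_lub (nat_order U) s {x, y}"
    "\<And>T h. (T, h) \<in> H \<Longrightarrow> h s = h x \<oplus>\<^bsub>T\<^esub> h y"
proof -
  obtain s where s: "s \<in> carrier U" "\<And>T h. (T, h) \<in> H \<Longrightarrow> h s = h x \<nabla>\<^bsub>T\<^esub> h y"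
    using add_ex[OF c] by blast
  have oT: "orthogonal T (h x) (h y)" if H: "(T, h) \<in> H" for T h
  proof -
    have "h (inv x \<cdot> y) = h \<zero>" "h (x \<cdot> inv y) = h \<zero>" using o by (simp_all add: orthogonal_def)
    then show ?thesis
      using c by (simp add: orthogonal_def h_mul[OF H] h_inv[OF H] h_zero[OF H])
  qed
  have hs: "h s = h x \<oplus>\<^bsub>T\<^esub> h y" if H: "(T, h) \<in> H" for T h
    using s(2)[OF H] bias.skew_add_orthogonal[OF bias[OF H] _ _ oT[OF H]] c h_closed[OF H] by simp
  have lT: "is_lub (nat_order T) (h s) {h x, h y}" if H: "(T, h) \<in> H" for T h
    using hs[OF H] bias.osum_lub[OF bias[OF H] _ _ oT[OF H]] c h_closed[OF H] by simp
  have "is_lub (nat_order U) s {x, y}"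
    by (rule U_lubI[OF c s(1) lT])
  then show ?thesis using that s(1) hs by blast
qed

lemma U_idem_lub:
  assumes c: "x \<in> idems U" "y \<in> idems U"
  obtains s where "s \<in> idems U" "is_lub (idem_order U) s {x, y}"
    "\<And>T h. (T, h) \<in> H \<Longrightarrow> h s = h x \<squnion>\<^bsub>idem_order T\<^esub> h y"
proof -
  obtain s where s: "s \<in> carrier U" "\<And>T h. (T, h) \<in> H \<Longrightarrow> h s = h x \<nabla>\<^bsub>T\<^esub> h y"
    using add_ex[of x y] c by auto
  have hs: "h s = h x \<squnion>\<^bsub>idem_order T\<^esub> h y" if H: "(T, h) \<in> H" for T h
    using s(2)[OF H] bias.skew_add_idem[OF bias[OF H]] c h_idem[OF H] by simp
  have lT: "is_lub (idem_order T) (h s) {h x, h y}" if H: "(T, h) \<in> H" for T h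
    using hs[OF H] bias.idem_lub[OF bias[OF H]] c h_idem[OF H] by simp
  have si: "s \<in> idems U"
  proof (rule U_idemI[OF s(1)])
    fix T h assume H: "(T, h) \<in> H"
    show "h s \<in> idems T"
      using least_closed[OF lT[OF H]]
      by (simp add: inverse_semigroup.idem_order_simps[OF T_inverse_semigroup[OF H]])
  qed
  then have "is_lub (idem_order U) s {x, y}"
    using U_idem_lubI c lT by blast
  then show ?thesis using that si hs by blast
qed

lemma U_join:
  assumes "x \<in> idems U" "y \<in> idems U"
  shows "x \<squnion>\<^bsub>idem_order U\<^esub> y \<in> idems U"
    and "(T, h) \<in> H \<Longrightarrow> h (x \<squnion>\<^bsub>idem_order U\<^esub> y) = h x \<squnion>\<^bsub>idem_order T\<^esub> h y"
proof -
  obtain s where s: "s \<in> idems U" "is_lub (idem_order U) s {x, y}"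
    "\<And>T h. (T, h) \<in> H \<Longrightarrow> h s = h x \<squnion>\<^bsub>idem_order T\<^esub> h y"
    using U_idem_lub[OF assms] by blast
  then show "x \<squnion>\<^bsub>idem_order U\<^esub> y \<in> idems U"
    "(T, h) \<in> H \<Longrightarrow> h (x \<squnion>\<^bsub>idem_order U\<^esub> y) = h x \<squnion>\<^bsub>idem_order T\<^esub> h y"
    using U.idem_join_eqI[OF s(2)] by simp_all
qed

lemma U_gba: "generalized_boolean_algebra (idem_order U)"
proof -
  interpret P: partial_order "idem_order U" by (rule U.idem_partial_order)
  show ?thesis
  proof
    fix x y assume "x \<in> carrier (idem_order U)" "y \<in> carrier (idem_order U)"
    then have c: "x \<in> idems U" "y \<in> idems U" by simp_all
    show "\<exists>s. is_lub (idem_order U) s {x, y}" using U_idem_lub[OF c] by metis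
    show "\<exists>s. is_glb (idem_order U) s {x, y}" using U.idem_glb[OF c] by blast
    {
      assume le: "x \<sqsubseteq>\<^bsub>idem_order U\<^esub> y"
      then have yx: "y \<cdot> x = x" using c by (simp add: U.idem_le_iff)
      obtain z where z: "z \<in> carrier U" "\<And>T h. (T, h) \<in> H \<Longrightarrow> h z = h y \<ominus>\<^bsub>T\<^esub> h x"
        using diff_ex[of y x] c by auto
      have hz: "h z = rel_diff (idem_order T) (h y) (h x)" if H: "(T, h) \<in> H" for T h
        using z(2)[OF H] bias.skew_diff_idem[OF bias[OF H]] c h_idem[OF H] by simp
      have zi: "z \<in> idems U"
      proof (rule U_idemI[OF z(1)])
        fix T h assume H: "(T, h) \<in> H"
        show "h z \<in> idems T"
          using hz[OF H] bias.diff_idem[OF bias[OF H]] c h_idem[OF H] by simp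
      qed
      have "z \<cdot> x = \<zero>"
      proof (rule sep)
        fix T h assume H: "(T, h) \<in> H"
        show "h (z \<cdot> x) = h \<zero>"
          using hz[OF H] bias.diff_orth[OF bias[OF H]] c h_idem[OF H] z(1)
          by (simp add: h_mul[OF H] h_zero[OF H])
      qed (use z c U_zero in \<open>auto simp: is_zero_def\<close>)
      moreover have "z \<squnion>\<^bsub>idem_order U\<^esub> x = y"
      proof (rule sep)
        fix T h assume H: "(T, h) \<in> H"
        have "h y \<cdot>\<^bsub>T\<^esub> h x = h x" using yx h_mul[OF H, of y x] c by simp
        then show "h (z \<squnion>\<^bsub>idem_order U\<^esub> x) = h y"
          using U_join(2)[OF zi c(1) H] hz[OF H] bias.diff_join[OF bias[OF H], of "h y" "h x"]
            c h_idem[OF H] by simp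
      qed (use U_join(1)[OF zi c(1)] c in auto)
      ultimately show "\<exists>z\<in>carrier (idem_order U).
          z \<sqinter>\<^bsub>idem_order U\<^esub> x = \<bottom>\<^bsub>idem_order U\<^esub> \<and> z \<squnion>\<^bsub>idem_order U\<^esub> x = y"
        using zi c U.idem_meet[OF zi c(1)] U.idem_bottom_eq(2)[OF U_zero] by auto
    }
    fix z assume "z \<in> carrier (idem_order U)"
    then have z: "z \<in> idems U" by simp
    have "x \<cdot> (y \<squnion>\<^bsub>idem_order U\<^esub> z) = (x \<cdot> y) \<squnion>\<^bsub>idem_order U\<^esub> (x \<cdot> z)"
    proof (rule sep)
      fix T h assume H: "(T, h) \<in> H"
      interpret T: bias T using H by (rule bias)
      interpret E: generalized_boolean_algebra "idem_order T" by (rule T.idems_gba)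
      have i: "h x \<in> idems T" "h y \<in> idems T" "h z \<in> idems T" using c z h_idem[OF H] by auto
      have "h x \<cdot>\<^bsub>T\<^esub> (h y \<squnion>\<^bsub>idem_order T\<^esub> h z)
          = (h x \<cdot>\<^bsub>T\<^esub> h y) \<squnion>\<^bsub>idem_order T\<^esub> (h x \<cdot>\<^bsub>T\<^esub> h z)"
        using E.meet_join_distrib[of "h x" "h y" "h z"] E.join_closed[of "h y" "h z"] i
        by (simp add: T.idem_meet)
      then show "h (x \<cdot> (y \<squnion>\<^bsub>idem_order U\<^esub> z)) = h ((x \<cdot> y) \<squnion>\<^bsub>idem_order U\<^esub> (x \<cdot> z))"
        using c z by (simp add: h_mul[OF H] U_join U_join(2)[OF _ _ H])
    qed (use c z U_join(1) in auto)
    then show "x \<sqinter>\<^bsub>idem_order U\<^esub> (y \<squnion>\<^bsub>idem_order U\<^esub> z) =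
        (x \<sqinter>\<^bsub>idem_order U\<^esub> y) \<squnion>\<^bsub>idem_order U\<^esub> (x \<sqinter>\<^bsub>idem_order U\<^esub> z)"
      using c z U_join(1) by (simp add: U.idem_meet)
  next
    show "\<exists>x. least (idem_order U) x (carrier (idem_order U))"
      using U.idem_bottom_eq(1)[OF U_zero] by auto
  qed
qed

theorem U_bias: "bias U"
proof (intro bias.intro bias_axioms.intro U_inverse_semigroup)
  show "\<exists>z. is_zero U z" using U_zero by blast
  show "generalized_boolean_algebra (idem_order U)" by (rule U_gba)
  show "\<exists>s. is_lub (nat_order U) s {x, y}"
    if "x \<in> carrier U" "y \<in> carrier U" "orthogonal U x y" for x y
    using U_orthogonal_lub[OF that] by metis
qed

theorem h_bias_hom:
  assumes H: "(T, h) \<in> H"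
  shows "h \<in> bias_hom U T"
proof -
  have "h (x \<oplus> y) = h x \<oplus>\<^bsub>T\<^esub> h y"
    if xy: "x \<in> carrier U" "y \<in> carrier U" "orthogonal U x y" for x y
  proof -
    obtain s where "s \<in> carrier U" "is_lub (nat_order U) s {x, y}"
      "\<And>T h. (T, h) \<in> H \<Longrightarrow> h s = h x \<oplus>\<^bsub>T\<^esub> h y"
      using U_orthogonal_lub[OF xy] by blast
    then show ?thesis using U.join_eqI H by metis
  qed
  then show ?thesis using h_hom[OF H] h_zero[OF H] by (auto simp: bias_hom_def)
qed

end


subsection \<open>Existence of the universal bias\<close>

lemma eval_cong:
  "t \<in> terms S \<Longrightarrow> (\<And>s. s \<in> carrier S \<Longrightarrow> f s = g s) \<Longrightarrow> eval T f t = eval T g t"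
  by (induction t) (auto simp: terms_def)

lemma terms_simps [simp]:
  "Gen s \<in> terms S \<longleftrightarrow> s \<in> carrier S"
  "Zero \<in> terms S"
  "Inv t \<in> terms S \<longleftrightarrow> t \<in> terms S"
  "Mul t u \<in> terms S \<longleftrightarrow> t \<in> terms S \<and> u \<in> terms S"
  "Diff t u \<in> terms S \<longleftrightarrow> t \<in> terms S \<and> u \<in> terms S"
  "Add t u \<in> terms S \<longleftrightarrow> t \<in> terms S \<and> u \<in> terms S"
  by (auto simp: terms_def)

context inverse_semigroup
begin

lemma generated_copy:
  assumes T: "bias T" and f: "f \<in> semigroup_hom S T"
  obtains V :: "'a bterm magma" and g where "bias V" "g \<in> semigroup_hom S V"
    "eval T f \<in> bias_hom V T"
    "\<And>s. s \<in> carrier S \<Longrightarrow> eval T f (g s) = f s"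
proof -
  interpret T: bias T by fact
  define r where "r t = (SOME u. u \<in> terms S \<and> eval T f u = eval T f t)" for t
  have r: "r t \<in> terms S \<and> eval T f (r t) = eval T f t" if "t \<in> terms S" for t
    unfolding r_def by (rule someI[of _ t]) (use that in simp)
  have r_cong: "r t = r u" if "eval T f t = eval T f u" for t u
    using that by (simp add: r_def)
  define V where "V = \<lparr>carrier = r ` terms S, mul = (\<lambda>p q. r (Mul p q))\<rparr>"
  have V: "carrier V = r ` terms S" "p \<cdot>\<^bsub>V\<^esub> q = r (Mul p q)" for p q
    by (simp_all add: V_def)
  have ex: "\<exists>z\<in>carrier V. eval T f z = eval T f t" if "t \<in> terms S" for t
    using r[OF that] that by (auto simp: V)
  have ct: "p \<in> terms S" if "p \<in> carrier V" for p
    using that r by (auto simp: V)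
  interpret sep: separating V "{(T, eval T f)}"
  proof (rule separating.intro, goal_cases)
    case (2 T' h x) then show ?case using ct T.eval_closed[OF f] by auto
  next
    case (3 T' h x y) then show ?case using ct r[of "Mul x y"] by (auto simp: V)
  next
    case (4 x y)
    then obtain t u where tu: "t \<in> terms S" "u \<in> terms S" "x = r t" "y = r u" by (auto simp: V)
    have "eval T f x = eval T f y" using 4(3)[of T "eval T f"] by simp
    then have "eval T f t = eval T f u" using r[OF tu(1)] r[OF tu(2)] tu(3,4) by simp
    then have "r t = r u" by (rule r_cong)
    then show ?case by (simp only: tu(3,4))
  next
    case (5 x y) then show ?case using ct by (auto simp: V)
  next
    case 6 show ?case using ex[of Zero] by simp
  next
    case (7 x) then show ?case using ex[of "Inv x"] ct by simp
  next
    case (8 x y) then show ?case using ex[of "Diff x y"] ct by simp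
  next
    case (9 x y) then show ?case using ex[of "Add x y"] ct by simp
  qed (use T in auto)
  have ff: "f (x \<cdot> y) = f x \<cdot>\<^bsub>T\<^esub> f y" if "x \<in> carrier S" "y \<in> carrier S" for x y
    using f that by (simp add: semigroup_hom_def)
  show ?thesis
  proof (rule that)
    show "bias V" by (rule sep.U_bias)
    show "eval T f \<in> bias_hom V T" by (rule sep.h_bias_hom) simp
    show "(\<lambda>s. r (Gen s)) \<in> semigroup_hom S V"
      by (auto simp: semigroup_hom_def V ff r intro!: r_cong)
    show "eval T f (r (Gen s)) = f s" if "s \<in> carrier S" for s
      using r[of "Gen s"] that by simp
  qed
qed

lemma equiv_term_eq: "equiv (terms S) (term_eq S)"
  by (rule equivI) (auto simp: term_eq_def refl_on_def sym_def trans_def)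

lemma term_eq_sound:
  assumes T: "bias T" and f: "f \<in> semigroup_hom S T" and tu: "(t, u) \<in> term_eq S"
  shows "eval T f t = eval T f u"
proof -
  obtain V :: "'a bterm magma" and g where V: "bias V" "g \<in> semigroup_hom S V"
    "eval T f \<in> bias_hom V T" "\<And>s. s \<in> carrier S \<Longrightarrow> eval T f (g s) = f s"
    using generated_copy[OF T f] by blast
  interpret p: bias_hom_pair V T "eval T f"
    using V T by (simp add: bias_hom_pair_def bias_hom_pair_axioms_def)
  have *: "eval T f t = eval T f (eval V g t)" if "t \<in> terms S" for t
    using p.h_eval[OF V(2) that] eval_cong[OF that, of "eval T f \<circ> g" f] V(4) by simp
  have "t \<in> terms S" "u \<in> terms S" "eval V g t = eval V g u"
    using tu V by (auto simp: term_eq_def)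
  then show ?thesis using *[of t] *[of u] by simp
qed

definition uval :: "'c magma \<Rightarrow> ('a \<Rightarrow> 'c) \<Rightarrow> 'a bterm set \<Rightarrow> 'c" where
  "uval T f X = eval T f (SOME t. t \<in> X)"

lemma uval_class:
  assumes "bias T" "f \<in> semigroup_hom S T" "t \<in> terms S"
  shows "uval T f (term_eq S `` {t}) = eval T f t"
proof -
  have "t \<in> term_eq S `` {t}" using assms by (simp add: term_eq_def)
  then have "(SOME u. u \<in> term_eq S `` {t}) \<in> term_eq S `` {t}" by (rule someI)
  then show ?thesis
    using term_eq_sound[OF assms(1,2)] by (simp add: uval_def)
qed

lemma U_carrier: "carrier (U_bis S) = (\<lambda>t. term_eq S `` {t}) ` terms S"
  by (auto simp: U_bis_def quotient_def)

lemma U_mul: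
  assumes "t \<in> terms S" "u \<in> terms S"
  shows "(term_eq S `` {t}) \<cdot>\<^bsub>U_bis S\<^esub> (term_eq S `` {u}) = term_eq S `` {Mul t u}"
proof -
  have "congruent2 (term_eq S) (term_eq S) (\<lambda>t u. term_eq S `` {Mul t u})"
    by (intro congruent2I' equiv_class_eq[OF equiv_term_eq]) (auto simp: term_eq_def)
  from UN_equiv_class2[OF equiv_term_eq equiv_term_eq this assms]
  show ?thesis by (simp add: U_bis_def)
qed

definition U_family :: "('a bterm magma \<times> ('a bterm set \<Rightarrow> 'a bterm)) set" where
  "U_family = {(T, uval T f) | T f. bias T \<and> f \<in> semigroup_hom S T}"

lemma U_separating: "separating (U_bis S) U_family"
proof -
  have ex: "\<exists>z\<in>carrier (U_bis S). \<forall>T f. bias (T :: 'a bterm magma) \<longrightarrow> f \<in> semigroup_hom S T \<longrightarrow>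
      uval T f z = eval T f t" if "t \<in> terms S" for t
    using that by (auto simp: U_carrier uval_class)
  show ?thesis
  proof (rule separating.intro, goal_cases)
    case (2 T h x)
    then show ?case by (auto simp: U_family_def U_carrier uval_class bias.eval_closed)
  next
    case (3 T h x y)
    then show ?case by (auto simp: U_family_def U_carrier uval_class U_mul)
  next
    case (4 x y)
    then obtain t u where tu: "t \<in> terms S" "u \<in> terms S"
      "x = term_eq S `` {t}" "y = term_eq S `` {u}" by (auto simp: U_carrier)
    have "eval T f t = eval T f u"
      if "bias T" "f \<in> semigroup_hom S T" for T :: "'a bterm magma" and f
      using 4(3)[of T "uval T f"] that tu by (auto simp: U_family_def uval_class)
    then have "(t, u) \<in> term_eq S" using tu by (simp add: term_eq_def)
    then show ?case using tu equiv_class_eq[OF equiv_term_eq] by simp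
  next
    case (5 x y) then show ?case by (auto simp: U_carrier U_mul)
  next
    case 6 show ?case using ex[of Zero] by (auto simp: U_family_def)
  next
    case (7 x)
    then obtain t where t: "t \<in> terms S" "x = term_eq S `` {t}" by (auto simp: U_carrier)
    then show ?case using ex[of "Inv t"] by (fastforce simp: U_family_def uval_class)
  next
    case (8 x y)
    then obtain t u where "t \<in> terms S" "u \<in> terms S"
      "x = term_eq S `` {t}" "y = term_eq S `` {u}" by (auto simp: U_carrier)
    then show ?case using ex[of "Diff t u"] by (fastforce simp: U_family_def uval_class)
  next
    case (9 x y)
    then obtain t u where "t \<in> terms S" "u \<in> terms S"
      "x = term_eq S `` {t}" "y = term_eq S `` {u}" by (auto simp: U_carrier)
    then show ?case using ex[of "Add t u"] by (fastforce simp: U_family_def uval_class)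
  qed (auto simp: U_family_def)
qed

theorem U_bis_bias: "bias (U_bis S)"
  by (rule separating.U_bias[OF U_separating])

theorem U_bis_unit_hom: "U_bis_unit S \<in> semigroup_hom S (U_bis S)"
proof -
  have "term_eq S `` {Gen (x \<cdot> y)} = term_eq S `` {Mul (Gen x) (Gen y)}"
    if "x \<in> carrier S" "y \<in> carrier S" for x y
    by (intro equiv_class_eq[OF equiv_term_eq])
       (use that in \<open>auto simp: term_eq_def semigroup_hom_def\<close>)
  then show ?thesis
    by (auto simp: semigroup_hom_def U_carrier U_bis_unit_def U_mul)
qed

lemma uval_bias_hom:
  assumes T: "bias T" and f: "f \<in> semigroup_hom S T"
  shows "uval T f \<in> bias_hom (U_bis S) T"
proof -
  obtain V :: "'a bterm magma" and g where V: "bias V" "g \<in> semigroup_hom S V"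
    "eval T f \<in> bias_hom V T" "\<And>s. s \<in> carrier S \<Longrightarrow> eval T f (g s) = f s"
    using generated_copy[OF T f] by blast
  interpret p: bias_hom_pair V T "eval T f"
    using V T by (simp add: bias_hom_pair_def bias_hom_pair_axioms_def)
  have "uval V g \<in> bias_hom (U_bis S) V"
    by (rule separating.h_bias_hom[OF U_separating]) (use V in \<open>auto simp: U_family_def\<close>)
  from bias_hom_comp[OF U_bis_bias V(1) T this V(3)]
  have c: "(\<lambda>X. eval T f (uval V g X)) \<in> bias_hom (U_bis S) T" .
  interpret c: bias_hom_pair "U_bis S" T "\<lambda>X. eval T f (uval V g X)"
    using c T U_bis_bias by (simp add: bias_hom_pair_def bias_hom_pair_axioms_def)
  have eq: "uval T f X = eval T f (uval V g X)" if "X \<in> carrier (U_bis S)" for X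
  proof -
    from that obtain t where t: "t \<in> terms S" "X = term_eq S `` {t}" by (auto simp: U_carrier)
    then show ?thesis
      using p.h_eval[OF V(2) t(1)] eval_cong[OF t(1), of "eval T f \<circ> g" f] V T f
      by (simp add: uval_class)
  qed
  show ?thesis
    unfolding bias_hom_def semigroup_hom_def
    by (auto simp: eq c.h_mul c.h_zero c.h_osum c.h_closed)
qed

lemma eval_U:
  assumes t: "t \<in> terms S"
  shows "eval (U_bis S) (U_bis_unit S) t = term_eq S `` {t}"
proof (rule separating.sep[OF U_separating])
  show "eval (U_bis S) (U_bis_unit S) t \<in> carrier (U_bis S)"
    by (rule bias.eval_closed[OF U_bis_bias U_bis_unit_hom t])
  show "term_eq S `` {t} \<in> carrier (U_bis S)" using t by (auto simp: U_carrier)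
  fix T h assume "(T, h) \<in> U_family"
  then obtain f where h: "h = uval T f" and T: "bias T" and f: "f \<in> semigroup_hom S T"
    by (auto simp: U_family_def)
  interpret p: bias_hom_pair "U_bis S" T "uval T f"
    using T U_bis_bias uval_bias_hom[OF T f]
    by (simp add: bias_hom_pair_def bias_hom_pair_axioms_def)
  show "h (eval (U_bis S) (U_bis_unit S) t) = h (term_eq S `` {t})"
    using p.h_eval[OF U_bis_unit_hom t] T f t
      eval_cong[OF t, of "uval T f \<circ> U_bis_unit S" f]
    by (simp add: h uval_class U_bis_unit_def)
qed

theorem U_bis_universal: "universal_bias TYPE('c) S (U_bis S) (U_bis_unit S)"
  unfolding universal_bias_def
proof (intro conjI allI impI)
  show "bias (U_bis S)" by (rule U_bis_bias)
  show "U_bis_unit S \<in> semigroup_hom S (U_bis S)" by (rule U_bis_unit_hom)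
  fix T :: "'c magma" and f assume T: "bias T" and f: "f \<in> semigroup_hom S T"
  show "\<exists>g\<in>bias_hom (U_bis S) T. (\<forall>s\<in>carrier S. g (U_bis_unit S s) = f s) \<and>
      (\<forall>g'\<in>bias_hom (U_bis S) T. (\<forall>s\<in>carrier S. g' (U_bis_unit S s) = f s) \<longrightarrow>
        (\<forall>u\<in>carrier (U_bis S). g' u = g u))"
  proof (intro bexI[where x = "uval T f"] conjI ballI impI)
    show "uval T f (U_bis_unit S s) = f s" if "s \<in> carrier S" for s
      using uval_class[OF T f, of "Gen s"] that by (simp add: U_bis_unit_def)
    show "uval T f \<in> bias_hom (U_bis S) T" by (rule uval_bias_hom[OF T f])
    fix g u
    assume g: "g \<in> bias_hom (U_bis S) T" "\<forall>s\<in>carrier S. g (U_bis_unit S s) = f s"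
      and "u \<in> carrier (U_bis S)"
    then obtain t where t: "t \<in> terms S" "u = term_eq S `` {t}" by (auto simp: U_carrier)
    interpret p: bias_hom_pair "U_bis S" T g
      using g T U_bis_bias by (simp add: bias_hom_pair_def bias_hom_pair_axioms_def)
    have "g u = eval T (g \<circ> U_bis_unit S) t"
      using p.h_eval[OF U_bis_unit_hom t(1)] eval_U[OF t(1)] t by simp
    also have "\<dots> = eval T f t" using g(2) by (intro eval_cong[OF t(1)]) simp
    finally show "g u = uval T f u" using t uval_class[OF T f] by simp
  qed
qed

end

end

theory Submission
  imports Defs
begin

text \<open>
  Let \<open>j\<close> map a finite inverse semigroup \<open>S\<close> into a bias. A bias that is finitely generated need not
  be finite, so finiteness has to come from the relations of \<open>S\<close>. It comes from a normal form:
  \<open>M = j(S) \<union> {0}\<close> is a finite inverse semigroup, and every element that the bias operations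
  produce from \<open>M\<close> agrees, on each of finitely many idempotents, with an element of \<open>M\<close>.

  In detail, let \<open>E\<close> be the finite set of idempotents of \<open>M\<close>. For \<open>e \<in> E\<close> let \<open>a\<^sub>e\<close> be what
  remains of \<open>e\<close> after removing all \<open>f \<in> E\<close> strictly below \<open>e\<close>. Two facts make these
  pieces useful.

    \<^item> They suffice: two elements that agree on every \<open>a\<^sub>e\<close>, in the sense \<open>x a\<^sub>e = y a\<^sub>e\<close>, agree on
      the join \<open>q\<close> of \<open>E\<close>. By induction along \<open>E\<close>, this reduces to the distributivity of
      multiplication over orthogonal joins (\<open>mul_idem_join_orth\<close>, \<open>agree_atoms\<close>).
    \<^item> They are carried to one another: for \<open>s \<in> M\<close>, the conjugate \<open>s a\<^sub>e s\<^sup>-\<^sup>1\<close> is again some \<open>a\<^sub>f\<close>. Conjugation by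
      \<open>s\<close> is an order isomorphism from the idempotents below \<open>s\<^sup>-\<^sup>1s\<close> to those below \<open>ss\<^sup>-\<^sup>1\<close>, and it
      preserves \<open>M\<close> (\<open>conj_atom\<close>, \<open>conj_atoms\<close>).

  Call \<open>x\<close> piecewise in \<open>M\<close> if \<open>x = xq\<close> and each \<open>x a\<^sub>e\<close> equals \<open>s a\<^sub>e\<close> for some \<open>s \<in> M\<close>. The first fact
  leaves only finitely many such \<open>x\<close>; the second makes them closed under multiplication. The
  elements \<open>x\<close> for which both \<open>x\<close> and \<open>x\<^sup>-\<^sup>1\<close> are piecewise in \<open>M\<close> are closed under all bias operations,
  hence form a finite bias \<open>V\<close> that contains \<open>j(S)\<close> (\<open>finite_subbias\<close>).

  If \<open>j\<close> is universal, it factors through \<open>V\<close> by some \<open>g\<close>. Followed by the inclusion of \<open>V\<close>, this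
  \<open>g\<close> is a bias endomorphism that fixes \<open>j(S)\<close> and so, by uniqueness, is the identity. Therefore
  \<open>V\<close> is the whole universal bias.
\<close>

section \<open>Conjugation of idempotents in inverse semigroups\<close>

context inverse_semigroup
begin

lemma d_lcomm:
  assumes "x \<in> carrier S" "e \<in> idems S"
  shows "inv x \<cdot> (x \<cdot> e) = e \<cdot> (inv x \<cdot> x)"
    and "z \<in> carrier S \<Longrightarrow> inv x \<cdot> (x \<cdot> (e \<cdot> z)) = e \<cdot> (inv x \<cdot> (x \<cdot> z))"
proof -
  have i: "inv x \<cdot> x \<in> idems S" using d_idems[OF assms(1)] by (simp add: d_idem_def)
  show "inv x \<cdot> (x \<cdot> e) = e \<cdot> (inv x \<cdot> x)"
    using idems_comm[OF i assms(2)] assms by (simp add: mul_assoc)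
  show "inv x \<cdot> (x \<cdot> (e \<cdot> z)) = e \<cdot> (inv x \<cdot> (x \<cdot> z))" if "z \<in> carrier S"
    using idems_lcomm[OF i assms(2) that] assms that by (simp add: mul_assoc)
qed

lemma conj_idem:
  assumes "x \<in> carrier S" "e \<in> idems S"
  shows "x \<cdot> (e \<cdot> inv x) \<in> idems S"
  by (rule idemsI) (use assms in \<open>simp_all add: mul_assoc d_lcomm inv_r\<close>)

lemma mul_idem_conj:
  assumes "x \<in> carrier S" "e \<in> idems S"
  shows "(x \<cdot> (e \<cdot> inv x)) \<cdot> x = x \<cdot> e"
  using assms by (simp add: mul_assoc d_lcomm(1)[symmetric] inv_l2)

lemma conj_cancel:
  assumes "x \<in> carrier S" "e \<in> idems S" "d_idem S x \<cdot> e = e"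
  shows "inv x \<cdot> ((x \<cdot> (e \<cdot> inv x)) \<cdot> x) = e"
  using assms by (simp add: mul_idem_conj) (simp add: d_idem_def mul_assoc)

lemma idem_mul_conj:
  assumes "x \<in> carrier S" "e \<in> idems S"
  shows "e \<cdot> x = x \<cdot> (inv x \<cdot> (e \<cdot> x))"
  using d_lcomm(2)[of "inv x" e x] assms by (simp add: inv_l)

lemma d_mul_idem:
  assumes "x \<in> carrier S" "e \<in> idems S"
  shows "d_idem S (x \<cdot> e) = d_idem S x \<cdot> e"
  using assms by (simp add: d_idem_def inv_mul mul_assoc d_lcomm(1))

lemma inv_mono:
  assumes "x \<in> carrier S" "y \<in> carrier S" "x \<sqsubseteq>\<^bsub>nat_order S\<^esub> y"
  shows "inv x \<sqsubseteq>\<^bsub>nat_order S\<^esub> inv y"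
proof (rule leI)
  show "inv y \<in> carrier S" "y \<cdot> (d_idem S x \<cdot> inv y) \<in> idems S"
    using assms by (simp_all add: conj_idem)
  have "x = y \<cdot> d_idem S x" using assms by (simp add: le_iff)
  then have "inv x = d_idem S x \<cdot> inv y" using assms inv_mul[of y "d_idem S x"] by simp
  also have "\<dots> = inv y \<cdot> (y \<cdot> (d_idem S x \<cdot> inv y))"
    using idem_mul_conj[of "inv y" "d_idem S x"] assms by simp
  finally show "inv x = inv y \<cdot> (y \<cdot> (d_idem S x \<cdot> inv y))" .
qed

end


section \<open>Distributivity in biases\<close>

context bias
begin

abbreviation idem_join :: "'a \<Rightarrow> 'a \<Rightarrow> 'a" (infixl \<open>\<squnion>\<^sub>E\<close> 65) where
  "e \<squnion>\<^sub>E f \<equiv> e \<squnion>\<^bsub>idem_order S\<^esub> f"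

abbreviation idem_diff :: "'a \<Rightarrow> 'a \<Rightarrow> 'a" where
  "idem_diff e f \<equiv> rel_diff (idem_order S) e f"

interpretation E: generalized_boolean_algebra "idem_order S"
  by (rule idems_gba)

lemma idem_join_closed [simp]: "\<lbrakk>e \<in> idems S; f \<in> idems S\<rbrakk> \<Longrightarrow> e \<squnion>\<^sub>E f \<in> idems S"
  using E.join_closed[of e f] by simp

lemma idem_join_zero [simp]: "e \<in> idems S \<Longrightarrow> e \<squnion>\<^sub>E \<zero> = e"
  using E.join_bottom[of e] by (simp add: bottom_eq)

lemma idem_mul_join_distrib:
  "\<lbrakk>g \<in> idems S; e \<in> idems S; f \<in> idems S\<rbrakk> \<Longrightarrow> g \<cdot> (e \<squnion>\<^sub>E f) = (g \<cdot> e) \<squnion>\<^sub>E (g \<cdot> f)"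
  using E.meet_join_distrib[of g e f] by (simp add: idem_meet)

lemma idem_join_mul_distrib:
  "\<lbrakk>g \<in> idems S; e \<in> idems S; f \<in> idems S\<rbrakk> \<Longrightarrow> (e \<squnion>\<^sub>E f) \<cdot> g = (e \<cdot> g) \<squnion>\<^sub>E (f \<cdot> g)"
  using idem_mul_join_distrib[of g e f] idems_comm[of g] by simp

lemma idem_join_absorb:
  assumes "e \<in> idems S" "f \<in> idems S"
  shows "(e \<squnion>\<^sub>E f) \<cdot> e = e" "(e \<squnion>\<^sub>E f) \<cdot> f = f"
  using E.join_left[of e f] E.join_right[of e f] assms by (simp_all add: idem_le_iff)

lemma idem_diff_join:
  assumes "e \<in> idems S" "f \<in> idems S"
  shows "idem_diff e f \<squnion>\<^sub>E f = e \<squnion>\<^sub>E f"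
  using skew_add_idem[OF assms] assms
  by (simp add: skew_add_def skew_diff_idem osum_idem diff_orth)

text \<open>
  An orthogonal sum is glued from its summands: it restricts to each of them on their domains and is
  supported on the join of these domains, for otherwise cutting it down to that join would give a
  smaller upper bound.
\<close>

lemma osum_restrict:
  assumes c: "x \<in> carrier S" "y \<in> carrier S" and o: "orthogonal S x y"
  shows "(x \<oplus> y) \<cdot> d_idem S x = x" "(x \<oplus> y) \<cdot> d_idem S y = y"
    and "(x \<oplus> y) \<cdot> (d_idem S x \<squnion>\<^sub>E d_idem S y) = x \<oplus> y"
proof -
  let ?z = "x \<oplus> y" and ?e = "d_idem S x \<squnion>\<^sub>E d_idem S y"
  have z: "?z \<in> carrier S" using assms by simp
  have l: "is_lub (nat_order S) ?z {x, y}" by (rule osum_lub[OF assms])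
  have i: "d_idem S x \<in> idems S" "d_idem S y \<in> idems S" "?e \<in> idems S" using c by simp_all
  have "x \<sqsubseteq>\<^bsub>nat_order S\<^esub> ?z" "y \<sqsubseteq>\<^bsub>nat_order S\<^esub> ?z"
    using least_Upper_above[OF l, of x] least_Upper_above[OF l, of y] c by simp_all
  then show x: "?z \<cdot> d_idem S x = x" and y: "?z \<cdot> d_idem S y = y"
    using c z by (simp_all add: le_iff)
  have "x = (?z \<cdot> ?e) \<cdot> d_idem S x" "y = (?z \<cdot> ?e) \<cdot> d_idem S y"
    using x y z i by (simp_all add: mul_assoc idem_join_absorb)
  then have "x \<sqsubseteq>\<^bsub>nat_order S\<^esub> ?z \<cdot> ?e" "y \<sqsubseteq>\<^bsub>nat_order S\<^esub> ?z \<cdot> ?e"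
    using leI[of "?z \<cdot> ?e" "d_idem S x" x] leI[of "?z \<cdot> ?e" "d_idem S y" y] z i by simp_all
  then have "?z \<sqsubseteq>\<^bsub>nat_order S\<^esub> ?z \<cdot> ?e"
    by (intro least_le[OF l]) (use z i c in \<open>auto simp: Upper_def\<close>)
  then have "?z = ?z \<cdot> ?e \<cdot> d_idem S ?z" using z i by (simp add: le_iff)
  also have "\<dots> = ?z \<cdot> ?e"
    using z i idems_comm[of ?e "d_idem S ?z"] mul_d[of ?z] mul_assoc[of ?z "d_idem S ?z" ?e]
    by (simp add: mul_assoc)
  finally show "?z \<cdot> ?e = ?z" by simp
qed

text \<open>
  The sum of \<open>xg\<close> and \<open>xk\<close> lies below \<open>x(g \<squnion> k)\<close>. Comparable elements with equal domains coincide, and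
  distributivity among idempotents shows that both domains are the restriction of the domain of
  \<open>x\<close> to \<open>g \<squnion> k\<close>.
\<close>

lemma mul_idem_join_orth:
  assumes x: "x \<in> carrier S" and i: "g \<in> idems S" "k \<in> idems S" and o: "g \<cdot> k = \<zero>"
  shows "x \<cdot> (g \<squnion>\<^sub>E k) = (x \<cdot> g) \<oplus> (x \<cdot> k)"
proof -
  let ?z = "g \<squnion>\<^sub>E k" and ?t = "(x \<cdot> g) \<oplus> (x \<cdot> k)"
  have c: "x \<cdot> g \<in> carrier S" "x \<cdot> k \<in> carrier S" and z: "?z \<in> idems S" using x i by auto
  have d: "d_idem S (x \<cdot> g) = d_idem S x \<cdot> g" "d_idem S (x \<cdot> k) = d_idem S x \<cdot> k"
    using x i by (simp_all add: d_mul_idem)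
  have gdk: "g \<cdot> (d_idem S x \<cdot> k) = \<zero>"
    using idems_lcomm[of g "d_idem S x" k] x i o by simp
  have orth: "orthogonal S (x \<cdot> g) (x \<cdot> k)"
  proof -
    have "g \<cdot> (inv x \<cdot> (x \<cdot> k)) = \<zero>" using gdk x i by (simp add: d_idem_def mul_assoc)
    moreover have "g \<cdot> (k \<cdot> inv x) = \<zero>" using o mul_assoc[of g k "inv x"] x i by simp
    ultimately show ?thesis using x i by (simp add: orthogonal_def inv_mul mul_assoc)
  qed
  have t: "?t \<in> carrier S" using c orth by simp
  note r = osum_restrict[OF c orth]
  have e: "d_idem S (x \<cdot> g) \<squnion>\<^sub>E d_idem S (x \<cdot> k) = d_idem S x \<cdot> ?z"
    using x i by (simp add: d idem_mul_join_distrib)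
  have "?t \<sqsubseteq>\<^bsub>nat_order S\<^esub> x \<cdot> ?z"
  proof (rule least_le[OF osum_lub[OF c orth]])
    have "x \<cdot> g = (x \<cdot> ?z) \<cdot> g" "x \<cdot> k = (x \<cdot> ?z) \<cdot> k"
      using x i z by (simp_all add: mul_assoc idem_join_absorb)
    then have "x \<cdot> g \<sqsubseteq>\<^bsub>nat_order S\<^esub> x \<cdot> ?z" "x \<cdot> k \<sqsubseteq>\<^bsub>nat_order S\<^esub> x \<cdot> ?z"
      using leI[of "x \<cdot> ?z" g "x \<cdot> g"] leI[of "x \<cdot> ?z" k "x \<cdot> k"] x i z by simp_all
    then show "x \<cdot> ?z \<in> Upper (nat_order S) {x \<cdot> g, x \<cdot> k}"
      using x z c by (auto simp: Upper_def)
  qed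
  then have t1: "?t = x \<cdot> ?z \<cdot> d_idem S ?t" using t x z by (simp add: le_iff)
  have "d_idem S ?t \<cdot> d_idem S (x \<cdot> g) = d_idem S (x \<cdot> g)"
    "d_idem S ?t \<cdot> d_idem S (x \<cdot> k) = d_idem S (x \<cdot> k)"
    using r(1,2) d_mul_idem[OF t, of "d_idem S (x \<cdot> g)"] d_mul_idem[OF t, of "d_idem S (x \<cdot> k)"] c
    by simp_all
  then have "d_idem S ?t \<cdot> (d_idem S x \<cdot> ?z) = d_idem S x \<cdot> ?z"
    using t c by (simp add: e[symmetric] idem_mul_join_distrib)
  moreover have "d_idem S ?t \<cdot> (d_idem S x \<cdot> ?z) = d_idem S ?t"
    using r(3) d_mul_idem[OF t, of "d_idem S x \<cdot> ?z"] x z by (simp add: e)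
  ultimately have "d_idem S ?t = d_idem S x \<cdot> ?z" by simp
  then have "?t = x \<cdot> (?z \<cdot> (d_idem S x \<cdot> ?z))" using t1 x z by (simp add: mul_assoc)
  also have "\<dots> = x \<cdot> ?z"
    using x z idems_lcomm[of ?z "d_idem S x" ?z] mul_d[of x] mul_assoc[of x "d_idem S x" ?z] by simp
  finally show ?thesis by simp
qed

text \<open>
  Replacing \<open>h\<close> by its difference with \<open>g\<close> makes the join orthogonal without changing it, so that
  \<open>mul_idem_join_orth\<close> applies.
\<close>

lemma agree_idem_join:
  assumes c: "x \<in> carrier S" "y \<in> carrier S" and i: "g \<in> idems S" "h \<in> idems S"
    and g: "x \<cdot> g = y \<cdot> g" and h: "x \<cdot> h = y \<cdot> h"
  shows "x \<cdot> (h \<squnion>\<^sub>E g) = y \<cdot> (h \<squnion>\<^sub>E g)"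
proof -
  let ?k = "idem_diff h g"
  have k: "?k \<in> idems S" "h \<cdot> ?k = ?k" using i diff_le by simp_all
  have "x \<cdot> ?k = y \<cdot> ?k"
    using h k c i mul_assoc[of x h ?k] mul_assoc[of y h ?k] by simp
  then have "x \<cdot> (?k \<squnion>\<^sub>E g) = y \<cdot> (?k \<squnion>\<^sub>E g)"
    using c i k g by (simp add: mul_idem_join_orth diff_orth)
  then show ?thesis using i by (simp add: idem_diff_join)
qed

text \<open>Inversion is an automorphism of the natural ordering, so it preserves joins.\<close>

lemma inv_osum:
  assumes c: "x \<in> carrier S" "y \<in> carrier S" and o: "orthogonal S x y"
  shows "inv (x \<oplus> y) = inv x \<oplus> inv y"
proof (rule join_eqI[symmetric], rule least_UpperI)
  let ?z = "x \<oplus> y"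
  note l = osum_lub[OF assms]
  have z: "?z \<in> carrier S" using assms by simp
  then show "inv ?z \<in> carrier (nat_order S)" by simp
  have up: "a \<sqsubseteq>\<^bsub>nat_order S\<^esub> ?z" if "a \<in> {x, y}" for a
    using least_Upper_above[OF l that] c by simp
  show "a \<sqsubseteq>\<^bsub>nat_order S\<^esub> inv ?z" if "a \<in> {inv x, inv y}" for a
    using that up[of x] up[of y] c z by (auto intro: inv_mono)
  show "inv ?z \<sqsubseteq>\<^bsub>nat_order S\<^esub> u" if "u \<in> Upper (nat_order S) {inv x, inv y}" for u
  proof -
    have u: "u \<in> carrier S" "inv x \<sqsubseteq>\<^bsub>nat_order S\<^esub> u" "inv y \<sqsubseteq>\<^bsub>nat_order S\<^esub> u"
      using that c by (auto simp: Upper_def)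
    then have "x \<sqsubseteq>\<^bsub>nat_order S\<^esub> inv u" "y \<sqsubseteq>\<^bsub>nat_order S\<^esub> inv u"
      using inv_mono[of "inv x" u] inv_mono[of "inv y" u] c by simp_all
    then have "?z \<sqsubseteq>\<^bsub>nat_order S\<^esub> inv u"
      by (intro least_le[OF l]) (use u c in \<open>auto simp: Upper_def\<close>)
    then show ?thesis using inv_mono[of ?z "inv u"] z u by simp
  qed
qed (use c in auto)


section \<open>Remainders and joins of finite sets of idempotents\<close>

text \<open>
  For finite \<open>F\<close> this is \<open>e\<close> minus the join of \<open>F\<close>. Maximality characterises it in terms of the
  multiplication alone, which makes its behaviour under conjugation easy to see.
\<close>

definition is_remainder :: "'a \<Rightarrow> 'a set \<Rightarrow> 'a \<Rightarrow> bool" where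
  "is_remainder e F a \<longleftrightarrow> a \<in> idems S \<and> e \<cdot> a = a \<and> (\<forall>f\<in>F. f \<cdot> a = \<zero>) \<and>
     (\<forall>b\<in>idems S. e \<cdot> b = b \<and> (\<forall>f\<in>F. f \<cdot> b = \<zero>) \<longrightarrow> a \<cdot> b = b)"

lemma is_remainder_unique: "is_remainder e F a \<Longrightarrow> is_remainder e F b \<Longrightarrow> a = b"
  using idems_comm[of a b] unfolding is_remainder_def by auto

text \<open>
  Induction on \<open>F\<close>: a new member \<open>f\<close> is subtracted from the remainder \<open>a\<close> found so far. For the
  agreement property, \<open>a\<close> is the join of \<open>a - f\<close> with \<open>af\<close>, and agreement on \<open>f\<close> gives agreement on \<open>af\<close>.
\<close>

lemma remainder_exists:
  assumes "finite F" "F \<subseteq> idems S" and e: "e \<in> idems S"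
  shows "\<exists>a. is_remainder e F a \<and>
    (\<forall>x\<in>carrier S. \<forall>y\<in>carrier S. x \<cdot> a = y \<cdot> a \<and> (\<forall>f\<in>F. x \<cdot> f = y \<cdot> f) \<longrightarrow> x \<cdot> e = y \<cdot> e)"
  using assms(1,2)
proof (induction rule: finite_induct)
  case empty
  show ?case using e by (intro exI[of _ e]) (auto simp: is_remainder_def)
next
  case (insert f F)
  have f: "f \<in> idems S" and F: "F \<subseteq> idems S" using insert.prems by auto
  from insert.IH[OF F] obtain a where a: "is_remainder e F a" and agree:
    "\<And>x y. \<lbrakk>x \<in> carrier S; y \<in> carrier S; x \<cdot> a = y \<cdot> a; \<forall>f\<in>F. x \<cdot> f = y \<cdot> f\<rbrakk> \<Longrightarrow> x \<cdot> e = y \<cdot> e"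
    by blast
  have ai: "a \<in> idems S" "e \<cdot> a = a" "\<And>g. g \<in> F \<Longrightarrow> g \<cdot> a = \<zero>"
    and amax: "\<And>b. \<lbrakk>b \<in> idems S; e \<cdot> b = b; \<forall>g\<in>F. g \<cdot> b = \<zero>\<rbrakk> \<Longrightarrow> a \<cdot> b = b"
    using a by (auto simp: is_remainder_def)
  let ?a = "idem_diff a f"
  have d: "?a \<in> idems S" "a \<cdot> ?a = ?a" "?a \<squnion>\<^sub>E (a \<cdot> f) = a" "f \<cdot> ?a = \<zero>"
    using ai f diff_orth[of a f] idems_comm[of f ?a] by (simp_all add: diff_le diff_join)
  have "is_remainder e (insert f F) ?a"
    unfolding is_remainder_def
  proof (intro conjI ballI impI)
    show "e \<cdot> ?a = ?a"
      using ai d e mul_assoc[of e a ?a] by simp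
    show "g \<cdot> ?a = \<zero>" if "g \<in> insert f F" for g
      using that ai d F mul_assoc[of g a ?a] by (auto simp: subset_iff)
    fix b assume b: "b \<in> idems S" and *: "e \<cdot> b = b \<and> (\<forall>g\<in>insert f F. g \<cdot> b = \<zero>)"
    then have "b = (?a \<squnion>\<^sub>E (a \<cdot> f)) \<cdot> b" using amax d by simp
    also have "\<dots> = ?a \<cdot> b"
      using d(1) ai(1) b f * by (subst idem_join_mul_distrib) (simp_all add: mul_assoc)
    finally show "?a \<cdot> b = b" by simp
  qed (rule d)
  moreover have "x \<cdot> e = y \<cdot> e"
    if c: "x \<in> carrier S" "y \<in> carrier S" and 1: "x \<cdot> ?a = y \<cdot> ?a"
      and 2: "\<forall>g\<in>insert f F. x \<cdot> g = y \<cdot> g" for x y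
  proof (rule agree[OF c])
    have "x \<cdot> (a \<cdot> f) = y \<cdot> (a \<cdot> f)"
      using 2 c ai f mul_assoc[of x f a] mul_assoc[of y f a] idems_comm[of a f] by simp
    then show "x \<cdot> a = y \<cdot> a"
      using agree_idem_join[OF c _ d(1) _ 1, of "a \<cdot> f"] d ai f by simp
  qed (use 2 in simp)
  ultimately show ?case by blast
qed

lemma idem_finite_join_exists:
  assumes "finite F" "F \<subseteq> idems S"
  shows "\<exists>q\<in>idems S. (\<forall>f\<in>F. f \<cdot> q = f) \<and>
    (\<forall>x\<in>carrier S. \<forall>y\<in>carrier S. (\<forall>f\<in>F. x \<cdot> f = y \<cdot> f) \<longrightarrow> x \<cdot> q = y \<cdot> q)"
  using assms
proof (induction rule: finite_induct)
  case empty
  show ?case by (intro bexI[of _ \<zero>]) auto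
next
  case (insert f F)
  have f: "f \<in> idems S" and F: "F \<subseteq> idems S" using insert.prems by auto
  from insert.IH[OF F] obtain q where q: "q \<in> idems S" "\<And>g. g \<in> F \<Longrightarrow> g \<cdot> q = g"
    "\<And>x y. \<lbrakk>x \<in> carrier S; y \<in> carrier S; \<forall>f\<in>F. x \<cdot> f = y \<cdot> f\<rbrakk> \<Longrightarrow> x \<cdot> q = y \<cdot> q"
    by blast
  have qj: "q \<squnion>\<^sub>E f \<in> idems S" using q(1) f by simp
  have "f \<cdot> (q \<squnion>\<^sub>E f) = f" "q \<cdot> (q \<squnion>\<^sub>E f) = q"
    using idem_join_absorb[OF q(1) f] idems_comm[OF qj] q(1) f by simp_all
  then have "g \<cdot> (q \<squnion>\<^sub>E f) = g" if "g \<in> insert f F" for g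
    using that q(1,2) F f qj mul_assoc[of g q "q \<squnion>\<^sub>E f"] by (auto simp: subset_iff)
  moreover have "x \<cdot> (q \<squnion>\<^sub>E f) = y \<cdot> (q \<squnion>\<^sub>E f)"
    if "x \<in> carrier S" "y \<in> carrier S" "\<forall>g\<in>insert f F. x \<cdot> g = y \<cdot> g" for x y
    using agree_idem_join[of x y f q] q(1) q(3)[of x y] f that by simp
  ultimately show ?case using qj by blast
qed

end


section \<open>The pieces cut out by a finite inverse subsemigroup\<close>

locale finite_inverse_subsemigroup = bias S for S :: "'a magma" (structure) +
  fixes M :: "'a set"
  assumes finite_M: "finite M" and M_subset: "M \<subseteq> carrier S" and zero_M: "\<zero> \<in> M"
    and mul_M: "\<lbrakk>x \<in> M; y \<in> M\<rbrakk> \<Longrightarrow> x \<cdot> y \<in> M"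
    and inv_M: "x \<in> M \<Longrightarrow> inv x \<in> M"
begin

lemma M_closed [simp]: "x \<in> M \<Longrightarrow> x \<in> carrier S"
  using M_subset by blast

definition below :: "'a \<Rightarrow> 'a set" where
  "below e = {f \<in> M \<inter> idems S. e \<cdot> f = f \<and> f \<noteq> e}"

text \<open>
  The largest part of \<open>e\<close> that no smaller idempotent of \<open>M\<close> meets. It is an atom of the generalized
  Boolean algebra generated by the idempotents of \<open>M\<close>, or zero, but it need not be an atom among
  all idempotents of the bias.
\<close>

definition atom :: "'a \<Rightarrow> 'a" where
  "atom e = (THE a. is_remainder e (below e) a)"

lemma below_finite: "finite (below e)" and below_idems: "below e \<subseteq> idems S"
  using finite_M by (auto simp: below_def)

lemma atom_remainder:
  assumes "e \<in> idems S"
  shows "is_remainder e (below e) (atom e)"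
proof -
  obtain a where "is_remainder e (below e) a"
    using remainder_exists[OF below_finite below_idems assms] by blast
  then show ?thesis
    unfolding atom_def by (rule theI) (blast intro: is_remainder_unique \<open>is_remainder e _ a\<close>)
qed

text \<open>The induction step for \<open>agree_atoms\<close>: \<open>e\<close> is covered by its atom and the idempotents below it.\<close>

lemma agree_atom:
  assumes "e \<in> idems S" "x \<in> carrier S" "y \<in> carrier S" "x \<cdot> atom e = y \<cdot> atom e"
    "\<And>f. f \<in> below e \<Longrightarrow> x \<cdot> f = y \<cdot> f"
  shows "x \<cdot> e = y \<cdot> e"
proof -
  obtain a where "is_remainder e (below e) a" and agree:
    "x \<cdot> a = y \<cdot> a \<Longrightarrow> (\<And>f. f \<in> below e \<Longrightarrow> x \<cdot> f = y \<cdot> f) \<Longrightarrow> x \<cdot> e = y \<cdot> e"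
    using remainder_exists[OF below_finite below_idems assms(1)] assms(2,3) by blast
  then have "atom e = a" using is_remainder_unique[OF atom_remainder[OF assms(1)]] by blast
  then show ?thesis using agree assms(4,5) by blast
qed

lemma atom_idem [simp]: "e \<in> idems S \<Longrightarrow> atom e \<in> idems S"
  and atom_le: "e \<in> idems S \<Longrightarrow> e \<cdot> atom e = atom e"
  and atom_below: "e \<in> idems S \<Longrightarrow> f \<in> below e \<Longrightarrow> f \<cdot> atom e = \<zero>"
  using atom_remainder by (auto simp: is_remainder_def)

lemma agree_atoms:
  assumes c: "x \<in> carrier S" "y \<in> carrier S"
    and a: "\<And>e. e \<in> M \<inter> idems S \<Longrightarrow> x \<cdot> atom e = y \<cdot> atom e" and e: "e \<in> M \<inter> idems S"
  shows "x \<cdot> e = y \<cdot> e"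
  using e
proof (induction "card (below e)" arbitrary: e rule: less_induct)
  case less
  show ?case
  proof (rule agree_atom)
    fix f assume f: "f \<in> below e"
    have "below f \<subset> below e"
    proof (rule psubsetI)
      have fi: "f \<in> idems S" "e \<cdot> f = f" "f \<noteq> e" using f by (auto simp: below_def)
      have ei: "e \<in> idems S" using less.prems by simp
      show "below f \<subseteq> below e"
      proof
        fix g assume "g \<in> below f"
        then have g: "g \<in> M" "g \<in> idems S" "f \<cdot> g = g" by (auto simp: below_def)
        have "e \<cdot> g = g" using mul_assoc[of e f g] fi g ei by simp
        moreover have "g \<noteq> e" using fi g idems_comm[of e f] ei by auto
        ultimately show "g \<in> below e" using g by (simp add: below_def)
      qed
      show "below f \<noteq> below e" using f by (auto simp: below_def)
    qed
    then have "card (below f) < card (below e)" by (simp add: psubset_card_mono below_finite)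
    then show "x \<cdot> f = y \<cdot> f" using less.hyps f by (simp add: below_def)
  qed (use less.prems a[of e] c in simp_all)
qed

text \<open>
  If \<open>f\<close> does not lie above \<open>e\<close>, then \<open>fe\<close> is strictly below \<open>e\<close> and still in \<open>M\<close>, so it was removed
  when the atom of \<open>e\<close> was formed.
\<close>

lemma idem_atom_cases:
  assumes "f \<in> M \<inter> idems S" "e \<in> M \<inter> idems S"
  shows "f \<cdot> atom e = \<zero> \<or> f \<cdot> e = e \<and> f \<cdot> atom e = atom e"
proof (cases "f \<cdot> e = e")
  case True
  then show ?thesis using atom_le[of e] mul_assoc[of f e "atom e"] assms by simp
next
  case False
  then have "f \<cdot> e \<in> below e"
    using assms idems_lcomm[of e f e] by (auto simp: below_def mul_M)
  then have "(f \<cdot> e) \<cdot> atom e = \<zero>" using atom_below[of e] assms by simp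
  then show ?thesis using assms atom_le[of e] by (simp add: mul_assoc)
qed

text \<open>
  Conjugation by \<open>s\<^sup>-\<^sup>1\<close> carries what lies strictly below \<open>ses\<^sup>-\<^sup>1\<close> to what lies strictly below \<open>e\<close>.
  Strictness is kept because conjugation by \<open>s\<close> undoes it.
\<close>

lemma conj_below:
  assumes s: "s \<in> M" and e: "e \<in> M \<inter> idems S" "d_idem S s \<cdot> e = e"
    and f: "f \<in> below (s \<cdot> (e \<cdot> inv s))"
  shows "inv s \<cdot> (f \<cdot> s) \<in> below e"
proof -
  have fi: "f \<in> M" "f \<in> idems S" "(s \<cdot> (e \<cdot> inv s)) \<cdot> f = f" "f \<noteq> s \<cdot> (e \<cdot> inv s)"
    using f by (auto simp: below_def)
  have i: "inv s \<cdot> (f \<cdot> s) \<in> idems S" using conj_idem[of "inv s" f] s fi by simp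
  have rf: "r_idem S s \<cdot> f = f"
    using fi(2,3) s e by (metis Int_iff M_closed idems_closed inv_closed mul_assoc mul_closed r_closed r_mul)
  have "inv s \<cdot> (f \<cdot> s) \<noteq> e"
  proof
    assume "inv s \<cdot> (f \<cdot> s) = e"
    then have "s \<cdot> (e \<cdot> inv s) = s \<cdot> ((inv s \<cdot> (f \<cdot> s)) \<cdot> inv s)" by simp
    also have "\<dots> = f"
      using conj_cancel[of "inv s" f] rf s fi by (simp add: d_idem_def r_idem_def)
    finally show False using fi by simp
  qed
  moreover have "e \<cdot> (inv s \<cdot> (f \<cdot> s)) = inv s \<cdot> (f \<cdot> s)"
  proof -
    have "inv s \<cdot> (f \<cdot> s) = inv s \<cdot> (((s \<cdot> (e \<cdot> inv s)) \<cdot> f) \<cdot> s)" by (simp only: fi(3))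
    also have "\<dots> = (d_idem S s \<cdot> e) \<cdot> (inv s \<cdot> (f \<cdot> s))"
      using s fi(1,2) e(1) by (simp add: mul_assoc d_idem_def)
    finally show ?thesis using e by simp
  qed
  ultimately show ?thesis using s fi i by (simp add: below_def mul_M inv_M)
qed

text \<open>
  The conditions that the atom of \<open>e\<close> is the largest idempotent to satisfy are transported by
  conjugation. This is used twice for \<open>conj_atom\<close>: with \<open>s\<close> to see that the conjugate satisfies the
  conditions at \<open>ses\<^sup>-\<^sup>1\<close>, and with \<open>s\<^sup>-\<^sup>1\<close> to pull any competitor back and compare it with the
  atom of \<open>e\<close>.
\<close>

lemma conj_remainder_candidate:
  assumes s: "s \<in> M" and e: "e \<in> M \<inter> idems S" "d_idem S s \<cdot> e = e"
    and b: "b \<in> idems S" "e \<cdot> b = b" "\<And>f. f \<in> below e \<Longrightarrow> f \<cdot> b = \<zero>"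
  shows "(s \<cdot> (e \<cdot> inv s)) \<cdot> (s \<cdot> (b \<cdot> inv s)) = s \<cdot> (b \<cdot> inv s)"
    and "f \<in> below (s \<cdot> (e \<cdot> inv s)) \<Longrightarrow> f \<cdot> (s \<cdot> (b \<cdot> inv s)) = \<zero>"
proof -
  have "(s \<cdot> (e \<cdot> inv s)) \<cdot> (s \<cdot> (b \<cdot> inv s)) = ((s \<cdot> (e \<cdot> inv s)) \<cdot> s) \<cdot> (b \<cdot> inv s)"
    using s e(1) b(1) by (simp add: mul_assoc)
  also have "\<dots> = s \<cdot> ((e \<cdot> b) \<cdot> inv s)"
    using s e(1) b(1) mul_idem_conj[of s e] by (simp add: mul_assoc)
  finally show "(s \<cdot> (e \<cdot> inv s)) \<cdot> (s \<cdot> (b \<cdot> inv s)) = s \<cdot> (b \<cdot> inv s)" using b by simp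
  assume f: "f \<in> below (s \<cdot> (e \<cdot> inv s))"
  then have fi: "f \<in> idems S" by (simp add: below_def)
  have "f \<cdot> (s \<cdot> (b \<cdot> inv s)) = (f \<cdot> s) \<cdot> (b \<cdot> inv s)"
    using s fi b by (simp add: mul_assoc)
  also have "\<dots> = s \<cdot> (((inv s \<cdot> (f \<cdot> s)) \<cdot> b) \<cdot> inv s)"
    by (subst idem_mul_conj) (use s fi b in \<open>simp_all add: mul_assoc\<close>)
  also have "\<dots> = \<zero>" using b(3)[OF conj_below[OF s e f]] s by simp
  finally show "f \<cdot> (s \<cdot> (b \<cdot> inv s)) = \<zero>" .
qed

lemma conj_atom:
  assumes s: "s \<in> M" and e: "e \<in> M \<inter> idems S" "d_idem S s \<cdot> e = e"
  shows "s \<cdot> (atom e \<cdot> inv s) = atom (s \<cdot> (e \<cdot> inv s))"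
proof (rule is_remainder_unique)
  let ?e = "s \<cdot> (e \<cdot> inv s)"
  have e': "?e \<in> M \<inter> idems S" using s e by (simp add: mul_M inv_M conj_idem)
  then show "is_remainder ?e (below ?e) (atom ?e)" by (intro atom_remainder) simp
  have ss: "inv s \<in> M" "inv (inv s) = s" using s by (simp_all add: inv_M)
  have de: "d_idem S (inv s) \<cdot> ?e = ?e"
    using s e by (simp add: d_idem_def mul_assoc inv_l2)
  have conj_back: "inv s \<cdot> (?e \<cdot> inv (inv s)) = e" using conj_cancel[of s e] s e ss by simp
  show "is_remainder ?e (below ?e) (s \<cdot> (atom e \<cdot> inv s))"
    unfolding is_remainder_def
  proof (intro conjI ballI impI)
    show "s \<cdot> (atom e \<cdot> inv s) \<in> idems S" using s e by (simp add: conj_idem)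
    show "?e \<cdot> (s \<cdot> (atom e \<cdot> inv s)) = s \<cdot> (atom e \<cdot> inv s)"
      and "\<And>f. f \<in> below ?e \<Longrightarrow> f \<cdot> (s \<cdot> (atom e \<cdot> inv s)) = \<zero>"
      using conj_remainder_candidate[OF s e, of "atom e"] e by (simp_all add: atom_le atom_below)
    fix b assume b: "b \<in> idems S" and *: "?e \<cdot> b = b \<and> (\<forall>f\<in>below ?e. f \<cdot> b = \<zero>)"
    let ?b = "inv s \<cdot> (b \<cdot> s)"
    have bi: "?b \<in> idems S" using conj_idem[of "inv s" b] s b by simp
    have "e \<cdot> ?b = ?b" "\<And>f. f \<in> below e \<Longrightarrow> f \<cdot> ?b = \<zero>"
      using conj_remainder_candidate[OF ss(1) e' de b] * s unfolding conj_back by simp_all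
    then have ab: "atom e \<cdot> ?b = ?b"
      using atom_remainder[of e] e bi by (simp add: is_remainder_def)
    have rb: "r_idem S s \<cdot> b = b"
      using * s e b by (metis Int_iff M_closed idems_closed inv_closed mul_assoc mul_closed r_closed r_mul)
    have sb: "s \<cdot> (?b \<cdot> inv s) = b"
      using conj_cancel[of "inv s" b] rb s b by (simp add: d_idem_def r_idem_def)
    have "(s \<cdot> (atom e \<cdot> inv s)) \<cdot> (s \<cdot> (?b \<cdot> inv s))
        = ((s \<cdot> (atom e \<cdot> inv s)) \<cdot> s) \<cdot> (?b \<cdot> inv s)"
      using s e(1) bi by (simp add: mul_assoc)
    also have "\<dots> = s \<cdot> ((atom e \<cdot> ?b) \<cdot> inv s)"
      using s e(1) bi mul_idem_conj[of s "atom e"] by (simp add: mul_assoc)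
    also have "\<dots> = b" by (simp only: ab sb)
    finally show "(s \<cdot> (atom e \<cdot> inv s)) \<cdot> b = b" by (simp only: sb)
  qed
qed

definition atoms :: "'a set" where
  "atoms = atom ` (M \<inter> idems S)"

lemma atoms_finite: "finite atoms"
  using finite_M by (simp add: atoms_def)

lemma atoms_idem [simp]: "a \<in> atoms \<Longrightarrow> a \<in> idems S"
  by (auto simp: atoms_def)

lemma zero_atoms: "\<zero> \<in> atoms"
proof -
  have "atom \<zero> = \<zero>" using atom_le[of \<zero>] by simp
  then show ?thesis using zero_M by (force simp: atoms_def)
qed

lemma d_M: "s \<in> M \<Longrightarrow> d_idem S s \<in> M \<inter> idems S"
  by (simp add: mul_M inv_M) (simp add: d_idem_def mul_M inv_M)

lemma d_M_atoms:
  assumes "s \<in> M" "a \<in> atoms"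
  shows "d_idem S s \<cdot> a = \<zero> \<or> d_idem S s \<cdot> a = a"
  using idem_atom_cases[OF d_M[OF assms(1)]] assms(2) by (auto simp: atoms_def)

text \<open>
  An atom is either below \<open>s\<^sup>-\<^sup>1s\<close>, where \<open>conj_atom\<close> applies, or disjoint from it, and then the conjugate
  is zero. Zero counts as an atom, since it is the atom of \<open>0 \<in> M\<close>.
\<close>

lemma conj_atoms:
  assumes s: "s \<in> M" and a: "a \<in> atoms"
  shows "s \<cdot> (a \<cdot> inv s) \<in> atoms"
proof -
  obtain e where e: "e \<in> M \<inter> idems S" "a = atom e" using a by (auto simp: atoms_def)
  have *: "s \<cdot> (a \<cdot> inv s) = s \<cdot> ((d_idem S s \<cdot> a) \<cdot> inv s)"
    using s a by (simp add: d_idem_def mul_assoc inv_l2)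
  from idem_atom_cases[OF d_M[OF s] e(1)] show ?thesis
  proof
    assume "d_idem S s \<cdot> atom e = \<zero>"
    then show ?thesis using * e s zero_atoms by simp
  next
    assume "d_idem S s \<cdot> e = e \<and> d_idem S s \<cdot> atom e = atom e"
    then have "s \<cdot> (a \<cdot> inv s) = atom (s \<cdot> (e \<cdot> inv s))" using conj_atom[OF s e(1)] e by simp
    moreover have "s \<cdot> (e \<cdot> inv s) \<in> M \<inter> idems S"
      using s e by (simp add: mul_M inv_M conj_idem)
    ultimately show ?thesis by (simp add: atoms_def)
  qed
qed

text \<open>
  The join of the idempotents of \<open>M\<close>, described by the two properties of it that matter below.
\<close>

definition top_idem :: "'a" where
  "top_idem = (SOME q. q \<in> idems S \<and> (\<forall>f\<in>M \<inter> idems S. f \<cdot> q = f) \<and>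
    (\<forall>x\<in>carrier S. \<forall>y\<in>carrier S. (\<forall>f\<in>M \<inter> idems S. x \<cdot> f = y \<cdot> f) \<longrightarrow> x \<cdot> q = y \<cdot> q))"

lemma top_idem:
  shows top_idem_idem [simp]: "top_idem \<in> idems S"
    and mul_top_idem: "f \<in> M \<inter> idems S \<Longrightarrow> f \<cdot> top_idem = f"
    and agree_top_idem: "\<lbrakk>x \<in> carrier S; y \<in> carrier S; \<And>f. f \<in> M \<inter> idems S \<Longrightarrow> x \<cdot> f = y \<cdot> f\<rbrakk>
      \<Longrightarrow> x \<cdot> top_idem = y \<cdot> top_idem"
proof -
  let ?P = "\<lambda>q. q \<in> idems S \<and> (\<forall>f\<in>M \<inter> idems S. f \<cdot> q = f) \<and>
    (\<forall>x\<in>carrier S. \<forall>y\<in>carrier S. (\<forall>f\<in>M \<inter> idems S. x \<cdot> f = y \<cdot> f) \<longrightarrow> x \<cdot> q = y \<cdot> q)"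
  have "finite (M \<inter> idems S)" "M \<inter> idems S \<subseteq> idems S" using finite_M by auto
  from idem_finite_join_exists[OF this] obtain q where "?P q" by blast
  then have P: "?P top_idem" unfolding top_idem_def by (rule someI[of ?P])
  show "top_idem \<in> idems S" using P by blast
  show "f \<cdot> top_idem = f" if "f \<in> M \<inter> idems S" using P that by blast
  show "x \<cdot> top_idem = y \<cdot> top_idem"
    if "x \<in> carrier S" "y \<in> carrier S" "\<And>f. f \<in> M \<inter> idems S \<Longrightarrow> x \<cdot> f = y \<cdot> f"
    using P that by blast
qed

section \<open>Elements that are piecewise in the subsemigroup\<close>

definition piecewise :: "'a set" where
  "piecewise = {x \<in> carrier S. x \<cdot> top_idem = x \<and> (\<forall>a\<in>atoms. \<exists>s\<in>M. x \<cdot> a = s \<cdot> a)}"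

lemma piecewise_closed [simp]: "x \<in> piecewise \<Longrightarrow> x \<in> carrier S"
  unfolding piecewise_def by blast

lemma piecewise_top: "x \<in> piecewise \<Longrightarrow> x \<cdot> top_idem = x"
  unfolding piecewise_def by blast

lemma piecewise_atom: "\<lbrakk>x \<in> piecewise; a \<in> atoms\<rbrakk> \<Longrightarrow> \<exists>s\<in>M. x \<cdot> a = s \<cdot> a"
  unfolding piecewise_def by blast

lemma piecewiseI:
  "\<lbrakk>x \<in> carrier S; x \<cdot> top_idem = x; \<And>a. a \<in> atoms \<Longrightarrow> \<exists>s\<in>M. x \<cdot> a = s \<cdot> a\<rbrakk> \<Longrightarrow> x \<in> piecewise"
  unfolding piecewise_def by blast

text \<open>
  A piecewise element is determined by its restrictions to the atoms, and each of these is one of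
  finitely many elements \<open>s \<cdot> a\<close>.
\<close>

lemma finite_piecewise: "finite piecewise"
proof (rule inj_on_finite[where f = "\<lambda>x. restrict (\<lambda>a. x \<cdot> a) atoms"])
  show "inj_on (\<lambda>x. restrict (\<lambda>a. x \<cdot> a) atoms) piecewise"
  proof (rule inj_onI)
    fix x y assume x: "x \<in> piecewise" and y: "y \<in> piecewise"
      and eq: "restrict (\<lambda>a. x \<cdot> a) atoms = restrict (\<lambda>a. y \<cdot> a) atoms"
    have atom: "x \<cdot> atom e = y \<cdot> atom e" if "e \<in> M \<inter> idems S" for e
      using fun_cong[OF eq, of "atom e"] that by (simp add: atoms_def)
    have "x \<cdot> f = y \<cdot> f" if "f \<in> M \<inter> idems S" for f
      by (rule agree_atoms[OF piecewise_closed[OF x] piecewise_closed[OF y] atom that])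
    then have "x \<cdot> top_idem = y \<cdot> top_idem"
      by (rule agree_top_idem[OF piecewise_closed[OF x] piecewise_closed[OF y]])
    then show "x = y" using x y by (simp add: piecewise_top)
  qed
  show "(\<lambda>x. restrict (\<lambda>a. x \<cdot> a) atoms) ` piecewise
      \<subseteq> PiE atoms (\<lambda>a. (\<lambda>s. s \<cdot> a) ` M)"
    using piecewise_atom by (intro image_subsetI restrict_PiE_iff[THEN iffD2]) blast
  show "finite (PiE atoms (\<lambda>a. (\<lambda>s. s \<cdot> a) ` M))"
    using finite_M by (intro finite_PiE atoms_finite) auto
qed

lemma M_piecewise:
  assumes s: "s \<in> M"
  shows "s \<in> piecewise"
proof (rule piecewiseI)
  show "s \<cdot> top_idem = s"
    using mul_assoc[of s "d_idem S s" top_idem] s by (simp add: mul_d mul_top_idem[OF d_M[OF s]])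
qed (use s in auto)

text \<open>
  On an atom \<open>a\<close>, replace \<open>y\<close> by some \<open>s \<in> M\<close>. Since \<open>sa = (sas\<^sup>-\<^sup>1)s\<close> and \<open>sas\<^sup>-\<^sup>1\<close> is again an atom, \<open>x\<close> can
  then be replaced by some \<open>t \<in> M\<close>, and \<open>xy\<close> acts on \<open>a\<close> as \<open>ts\<close>.
\<close>

lemma mul_piecewise:
  assumes x: "x \<in> piecewise" and y: "y \<in> piecewise"
  shows "x \<cdot> y \<in> piecewise"
proof -
  have "\<exists>u\<in>M. x \<cdot> y \<cdot> a = u \<cdot> a" if a: "a \<in> atoms" for a
  proof -
    obtain s where s: "s \<in> M" "y \<cdot> a = s \<cdot> a" using piecewise_atom[OF y a] by blast
    obtain t where t: "t \<in> M" "x \<cdot> (s \<cdot> (a \<cdot> inv s)) = t \<cdot> (s \<cdot> (a \<cdot> inv s))"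
      using piecewise_atom[OF x conj_atoms[OF s(1) a]] by blast
    have sa: "s \<cdot> a = (s \<cdot> (a \<cdot> inv s)) \<cdot> s" using mul_idem_conj[of s a] s a by simp
    have "x \<cdot> y \<cdot> a = x \<cdot> (s \<cdot> a)" using x y a s by (simp add: mul_assoc)
    also have "\<dots> = (x \<cdot> (s \<cdot> (a \<cdot> inv s))) \<cdot> s"
      unfolding sa using x s a by (simp add: mul_assoc)
    also have "\<dots> = t \<cdot> (s \<cdot> a)" unfolding t sa using t s a by (simp add: mul_assoc)
    also have "\<dots> = (t \<cdot> s) \<cdot> a" using t s a by (simp add: mul_assoc)
    finally show ?thesis using s t mul_M by blast
  qed
  then show ?thesis
    using x y by (intro piecewiseI) (simp_all add: mul_assoc piecewise_top)
qed

text \<open>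
  The domain of a piecewise element does not split atoms. Differences and orthogonal sums can
  therefore be computed atom by atom: on a given atom, each operand is either undefined or defined
  throughout.
\<close>

lemma d_piecewise_atoms:
  assumes x: "x \<in> piecewise" and a: "a \<in> atoms"
  shows "d_idem S x \<cdot> a = \<zero> \<or> d_idem S x \<cdot> a = a"
proof -
  obtain s where s: "s \<in> M" "x \<cdot> a = s \<cdot> a" using piecewise_atom[OF x a] by blast
  then have "d_idem S x \<cdot> a = d_idem S s \<cdot> a"
    using d_mul_idem[of x a] d_mul_idem[of s a] x a by simp
  then show ?thesis using d_M_atoms[OF s(1) a] by simp
qed

lemma idem_diff_piecewise:
  assumes e: "e \<in> piecewise" "e \<in> idems S" and f: "f \<in> piecewise" "f \<in> idems S"
  shows "idem_diff e f \<in> piecewise"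
proof -
  let ?d = "idem_diff e f"
  have d: "?d \<in> idems S" "e \<cdot> ?d = ?d" "?d \<cdot> f = \<zero>" "?d \<squnion>\<^sub>E (e \<cdot> f) = e"
    using e f by (simp_all add: diff_le diff_orth diff_join)
  have de: "?d \<cdot> e = ?d" using idems_comm[OF d(1) e(2)] d(2) by simp
  have top: "?d \<cdot> top_idem = ?d"
    using mul_assoc[of ?d e top_idem] d(1) e de by (simp add: piecewise_top)
  have "\<exists>s\<in>M. ?d \<cdot> a = s \<cdot> a" if a: "a \<in> atoms" for a
  proof -
    from d_piecewise_atoms[OF f(1) a] have "f \<cdot> a = \<zero> \<or> f \<cdot> a = a" using f by simp
    then show ?thesis
    proof
      assume fa: "f \<cdot> a = \<zero>"
      have "e \<cdot> a = (?d \<squnion>\<^sub>E (e \<cdot> f)) \<cdot> a" using d by simp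
      also have "\<dots> = ?d \<cdot> a"
        using d(1) e f a fa by (simp add: idem_join_mul_distrib mul_assoc)
      finally show ?thesis using piecewise_atom[OF e(1) a] by simp
    next
      assume "f \<cdot> a = a"
      then have "?d \<cdot> a = (?d \<cdot> f) \<cdot> a" using d(1) f a by (simp add: mul_assoc)
      then have "?d \<cdot> a = \<zero> \<cdot> a" using d by simp
      then show ?thesis using zero_M by blast
    qed
  qed
  then show ?thesis using d(1) top by (intro piecewiseI) simp_all
qed

lemma osum_piecewise:
  assumes x: "x \<in> piecewise" and y: "y \<in> piecewise" and o: "orthogonal S x y"
  shows "x \<oplus> y \<in> piecewise"
proof -
  let ?z = "x \<oplus> y" and ?e = "d_idem S x \<squnion>\<^sub>E d_idem S y"
  have z: "?z \<in> carrier S" and i: "?e \<in> idems S" using assms by simp_all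
  note r = osum_restrict[OF piecewise_closed[OF x] piecewise_closed[OF y] o]
  have dtop: "d_idem S w \<cdot> top_idem = d_idem S w" if "w \<in> piecewise" for w
    using d_mul_idem[of w top_idem] piecewise_top[OF that] that by simp
  have "?z \<cdot> top_idem = ?z \<cdot> (?e \<cdot> top_idem)"
    using r(3) mul_assoc[of ?z ?e top_idem] z i by simp
  also have "?e \<cdot> top_idem = ?e" using x y by (simp add: idem_join_mul_distrib dtop)
  finally have top: "?z \<cdot> top_idem = ?z" using r(3) by simp
  have "\<exists>s\<in>M. ?z \<cdot> a = s \<cdot> a" if a: "a \<in> atoms" for a
  proof -
    have restr: "?z \<cdot> a = w \<cdot> a"
      if "w \<in> piecewise" "?z \<cdot> d_idem S w = w" "d_idem S w \<cdot> a = a" for w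
      using that z a mul_assoc[of ?z "d_idem S w" a] by simp
    consider "d_idem S x \<cdot> a = a" | "d_idem S y \<cdot> a = a"
      | "d_idem S x \<cdot> a = \<zero>" "d_idem S y \<cdot> a = \<zero>"
      using d_piecewise_atoms[OF x a] d_piecewise_atoms[OF y a] by blast
    then show ?thesis
    proof cases
      case 1 then show ?thesis using restr[OF x r(1)] piecewise_atom[OF x a] by simp
    next
      case 2 then show ?thesis using restr[OF y r(2)] piecewise_atom[OF y a] by simp
    next
      case 3
      then have "?e \<cdot> a = \<zero>" using x y a by (simp add: idem_join_mul_distrib)
      then have "?z \<cdot> a = \<zero> \<cdot> a" using r(3) mul_assoc[of ?z ?e a] z i a by simp
      then show ?thesis using zero_M by blast
    qed
  qed
  then show ?thesis using z top by (intro piecewiseI) simp_all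
qed

text \<open>
  The condition \<open>piecewise\<close> concerns restriction on the right only; imposing it on the inverse as well
  makes it symmetric, so that closure under inversion is immediate.
\<close>

definition bipiecewise :: "'a set" where
  "bipiecewise = {x \<in> piecewise. inv x \<in> piecewise}"

lemma bipiecewise_closed [simp]: "x \<in> bipiecewise \<Longrightarrow> x \<in> carrier S"
  by (simp add: bipiecewise_def)

lemma M_bipiecewise: "M \<subseteq> bipiecewise"
  by (auto simp: bipiecewise_def M_piecewise inv_M)

lemma inv_bipiecewise: "x \<in> bipiecewise \<Longrightarrow> inv x \<in> bipiecewise"
  by (simp add: bipiecewise_def)

lemma mul_bipiecewise: "\<lbrakk>x \<in> bipiecewise; y \<in> bipiecewise\<rbrakk> \<Longrightarrow> x \<cdot> y \<in> bipiecewise"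
  by (simp add: bipiecewise_def mul_piecewise inv_mul)

lemma skew_diff_bipiecewise:
  assumes x: "x \<in> bipiecewise" and y: "y \<in> bipiecewise"
  shows "x \<ominus> y \<in> bipiecewise"
proof -
  have "idem_diff e f \<in> bipiecewise"
    if "e \<in> bipiecewise" "f \<in> bipiecewise" "e \<in> idems S" "f \<in> idems S" for e f
    using that idem_diff_piecewise[of e f] by (simp add: bipiecewise_def)
  moreover have "d_idem S w \<in> bipiecewise" "r_idem S w \<in> bipiecewise" if "w \<in> bipiecewise" for w
    using that by (simp_all add: d_idem_def r_idem_def mul_bipiecewise inv_bipiecewise)
  ultimately show ?thesis
    using x y by (simp add: skew_diff_def mul_bipiecewise)
qed

lemma skew_add_bipiecewise:
  assumes x: "x \<in> bipiecewise" and y: "y \<in> bipiecewise"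
  shows "x \<nabla> y \<in> bipiecewise"
proof -
  have d: "x \<ominus> y \<in> bipiecewise" by (rule skew_diff_bipiecewise[OF assms])
  have o: "orthogonal S (x \<ominus> y) y" using x y by (intro skew_diff_orthogonal) auto
  have "orthogonal S (inv (x \<ominus> y)) (inv y)"
    using o d y by (auto simp: orthogonal_def)
  then show ?thesis
    using d y o
    by (simp add: skew_add_def bipiecewise_def osum_piecewise inv_osum)
qed

section \<open>The finite bias of piecewise elements and universality\<close>

definition subbias :: "'a magma" where
  "subbias = \<lparr>carrier = bipiecewise, mul = mul S\<rparr>"

lemma subbias_simps [simp]:
  "carrier subbias = bipiecewise" "x \<cdot>\<^bsub>subbias\<^esub> y = x \<cdot> y"
  by (simp_all add: subbias_def)

text \<open>
  The inclusion alone separates points, so closure under the bias operations is all that is needed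
  for a bias.
\<close>

lemma subbias_separating: "separating subbias {(S, \<lambda>x. x)}"
proof (rule separating.intro, goal_cases)
  case 6
  then show ?case using M_bipiecewise zero_M by auto
qed (use bias_axioms in \<open>auto simp: mul_bipiecewise inv_bipiecewise skew_diff_bipiecewise
  skew_add_bipiecewise\<close>)

lemma subbias_finite: "finite (carrier subbias)"
  using finite_piecewise by (simp add: bipiecewise_def)

end

text \<open>
  Adjoining zero to the image of \<open>j\<close> gives a finite inverse subsemigroup with zero, to which the
  construction above applies.
\<close>

lemma (in bias) finite_subbias:
  assumes A: "inverse_semigroup A" "finite (carrier A)" and j: "j \<in> semigroup_hom A S"
  obtains V where "bias V" "finite (carrier V)" "(\<lambda>x. x) \<in> bias_hom V S" "j \<in> semigroup_hom A V"
proof -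
  interpret A: inverse_semigroup A by fact
  have jc: "j x \<in> carrier S" if "x \<in> carrier A" for x
    using j that by (auto simp: semigroup_hom_def)
  have jm: "j x \<cdot> j y = j (x \<cdot>\<^bsub>A\<^esub> y)" if "x \<in> carrier A" "y \<in> carrier A" for x y
    using j that by (auto simp: semigroup_hom_def)
  interpret M: finite_inverse_subsemigroup S "insert \<zero> (j ` carrier A)"
  proof
    show "x \<cdot> y \<in> insert \<zero> (j ` carrier A)"
      if "x \<in> insert \<zero> (j ` carrier A)" "y \<in> insert \<zero> (j ` carrier A)" for x y
      using that by (auto simp: jc jm)
    show "inv x \<in> insert \<zero> (j ` carrier A)" if "x \<in> insert \<zero> (j ` carrier A)" for x
      using that A.hom_inv[OF inverse_semigroup_axioms j, symmetric] by auto
  qed (use A jc in auto)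
  show ?thesis
  proof (rule that)
    show "bias M.subbias" by (rule separating.U_bias[OF M.subbias_separating])
    show "(\<lambda>x. x) \<in> bias_hom M.subbias S"
      by (rule separating.h_bias_hom[OF M.subbias_separating]) simp
    show "finite (carrier M.subbias)" by (rule M.subbias_finite)
    show "j \<in> semigroup_hom A M.subbias"
      using M.M_bipiecewise jm by (auto simp: semigroup_hom_def)
  qed
qed

theorem corollary3p3:
  fixes S :: "'a magma" and U :: "'u magma" and j :: "'a \<Rightarrow> 'u"
  assumes "inverse_semigroup S"
    and "finite (carrier S)"
    and "universal_bias TYPE('u) S U j"
  shows "finite (carrier U)"
proof -
  have U: "bias U" and j: "j \<in> semigroup_hom S U"
    using assms(3) by (simp_all add: universal_bias_def)
  interpret U: bias U by fact
  obtain V :: "'u magma" where V: "bias V" "finite (carrier V)" "(\<lambda>x. x) \<in> bias_hom V U"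
    "j \<in> semigroup_hom S V"
    using U.finite_subbias[OF assms(1,2) j] by blast
  obtain g where g: "g \<in> bias_hom U V" "\<forall>s\<in>carrier S. g (j s) = j s"
    using assms(3) V(1,4) unfolding universal_bias_def by blast
  \<comment> \<open>Apply uniqueness to the test bias \<open>U\<close> itself: \<open>g\<close> and the identity both extend \<open>j\<close>.\<close>
  have g': "g \<in> bias_hom U U" using bias_hom_comp[OF U V(1) U g(1) V(3)] by simp
  have id: "(\<lambda>x. x) \<in> bias_hom U U" by (simp add: bias_hom_def semigroup_hom_def)
  obtain k where "\<forall>h\<in>bias_hom U U. (\<forall>s\<in>carrier S. h (j s) = j s) \<longrightarrow>
      (\<forall>u\<in>carrier U. h u = k u)"
    using assms(3) U j unfolding universal_bias_def by blast
  from bspec[OF this g'] bspec[OF this id] g(2)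
  have "\<forall>u\<in>carrier U. g u = k u" "\<forall>u\<in>carrier U. u = k u" by simp_all
  then have "g u = u" if "u \<in> carrier U" for u using that by metis
  moreover have "g u \<in> carrier V" if "u \<in> carrier U" for u
    using g(1) that by (auto simp: bias_hom_def semigroup_hom_def)
  ultimately have "carrier U \<subseteq> carrier V" by force
  then show ?thesis using V(2) finite_subset by blast
qed

end
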